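(* Let $n\ge3$, let $x_1<\dots<x_n$ be real numbers, and let $g\sim\mathcal{N}(0,I_{n\times n})$. Then $$\delta(\mathcal{K}^C_{x_1,\dots,x_n})=\mathbb{E}\left[\left|\Pi_{\mathcal{K}^C_{x_1,\dots,x_n}}(g)\right|_2^2\right]\le8\log(en).$$
   Context: $\mathcal{K}^C_{x_1,\dots,x_n}=\left\{u\in\mathbb{R}^n:\ \frac{u_i-u_{i-1}}{x_i-x_{i-1}}\le\frac{u_{i+1}-u_i}{x_{i+1}-x_i},\ i=2,\dots,n-1\right\}$, equivalently the set of vectors $(f(x_1),\dots,f(x_n))^T$ with $f:\mathbb{R}\to\mathbb{R}$ convex. $|\cdot|_2$ is the Euclidean norm and $\Pi_L$ is the Euclidean projection onto a closed convex cone $L$. The statistical dimension of a closed convex cone $L\subset\mathbb{R}^n$ is $\delta(L)=\mathbb{E}\left[|\Pi_L(g)|_2^2\right]$. *)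

theory Defs
  imports "HOL-Probability.Probability"
begin

text \<open>
  \<open>\<real>\<^sup>n\<close> is \<open>real ^ 'n\<close> with a linearly ordered finite index type, where \<open>n = CARD('n)\<close>.
  The \<open>i\<close>-th coordinate of \<open>u\<close>, for \<open>1 \<le> i \<le> n\<close>, is \<open>u $ idx i\<close>.
\<close>

definition idx :: "nat \<Rightarrow> 'n::{finite, linorder}" where
  "idx i = sorted_list_of_set UNIV ! (i - 1)"

definition convex_seq_cone :: "real ^ 'n::{finite, linorder} \<Rightarrow> (real ^ 'n::{finite, linorder}) set" where
  "convex_seq_cone x =
    {u. \<forall>i\<in>{2..CARD('n) - 1}.
      (u $ idx i - u $ idx (i - 1)) / (x $ idx i - x $ idx (i - 1))
        \<le> (u $ idx (i + 1) - u $ idx i) / (x $ idx (i + 1) - x $ idx i)}"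

definition std_gaussian_density :: "real ^ 'n::finite \<Rightarrow> real" where
  "std_gaussian_density z = (\<Prod>i\<in>UNIV. std_normal_density (z $ i))"

definition std_gaussian :: "(real ^ 'n::finite) measure" where
  "std_gaussian = density lborel (\<lambda>z. ennreal (std_gaussian_density z))"

definition statistical_dimension :: "(real ^ 'n::finite) set \<Rightarrow> real" where
  "statistical_dimension L = (LINT z|std_gaussian. (norm (closest_point L z))\<^sup>2)"

end

theory Submission
  imports Defs
begin

text \<open>
  A convex sequence decreases up to some index \<open>j\<close> and increases afterwards, so the squared norm \<open>V\<close> of
  the projection of \<open>g\<close> is at most the maximum over \<open>j\<close> of the sum of the squared norms of two isotonic
  projections, of \<open>j\<close> and of \<open>n - j\<close> independent Gaussians. Let \<open>Z n\<close> be the expectation of \<open>exp (t * W)\<close>,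
  where \<open>W\<close> is the squared norm of the isotonic projection of \<open>n\<close> Gaussians. For \<open>t = 3/8\<close> we have
  \<open>Z n \<le> n + 1\<close>; the expectation of \<open>exp (3/8 * V)\<close> is then at most
  \<open>\<Sum>j\<le>n. Z j * Z (n - j) \<le> (n + 1)^3 \<le> (e n)^3\<close>, and Jensen gives \<open>E V \<le> 8/3 * ln ((e n)^3)\<close>.

  To bound \<open>Z n\<close>, sum the lengths of the level blocks of the isotonic projection, which add up to \<open>n\<close>.
  A block of length \<open>k\<close> with mean \<open>a\<close> has prefix sums at least those of the constant sequence \<open>a\<close>; almost
  surely at most one cyclic shift of a sequence has this property, hence it has probability at most \<open>1/k\<close>
  given the mean. Once the block is deleted, its position is the strict minimiser of the random walk formed
  by the remaining values minus \<open>a\<close>, so there is at most one such position. Up to here the distribution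
  need only be atomless. For Gaussians, the expectation of \<open>exp (t * k * a^2)\<close> is \<open>1 / sqrt (1 - 2 * t)\<close>,
  which is \<open>2\<close> for \<open>t = 3/8\<close>, and this gives \<open>n * Z n \<le> 2 * (\<Sum>k=1..n. Z (n - k))\<close>.
\<close>

section \<open>Isotonic regression\<close>

text \<open>
  \<open>|x|^2 - |x - u|^2\<close> on the first \<open>n\<close> coordinates, so that its supremum over monotone \<open>u\<close> is the squared
  norm of the projection of \<open>x\<close> onto the monotone cone.
\<close>

definition fit_gain :: "nat \<Rightarrow> (nat \<Rightarrow> real) \<Rightarrow> (nat \<Rightarrow> real) \<Rightarrow> real" where
  "fit_gain n x u = (\<Sum>i<n. 2 * x i * u i - (u i)\<^sup>2)"

definition isotonic_gain :: "nat \<Rightarrow> (nat \<Rightarrow> real) \<Rightarrow> real" where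
  "isotonic_gain n x = (SUP u\<in>{u. mono_on {..<n} u}. fit_gain n x u)"

definition isotonic_fit :: "nat \<Rightarrow> (nat \<Rightarrow> real) \<Rightarrow> (nat \<Rightarrow> real) \<Rightarrow> bool" where
  "isotonic_fit n x p \<longleftrightarrow> mono_on {..<n} p \<and> (\<forall>u. mono_on {..<n} u \<longrightarrow> fit_gain n x u \<le> fit_gain n x p)"

lemma fit_gain_le_sum_squares: "fit_gain n x u \<le> (\<Sum>i<n. (x i)\<^sup>2)"
  unfolding fit_gain_def
proof (rule sum_mono)
  show "2 * x i * u i - (u i)\<^sup>2 \<le> (x i)\<^sup>2" for i
    using zero_le_power2[of "x i - u i"] by (simp add: power2_diff)
qed

lemma bdd_above_fit_gain: "bdd_above (fit_gain n x ` U)"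
  by (intro bdd_aboveI2[of _ _ "\<Sum>i<n. (x i)\<^sup>2"] fit_gain_le_sum_squares)

lemma fit_gain_le_isotonic_gain: "mono_on {..<n} u \<Longrightarrow> fit_gain n x u \<le> isotonic_gain n x"
  unfolding isotonic_gain_def by (intro cSUP_upper bdd_above_fit_gain) simp

lemma isotonic_gain_eq_fit_gain:
  assumes "isotonic_fit n x p"
  shows "isotonic_gain n x = fit_gain n x p"
proof (rule antisym)
  show "isotonic_gain n x \<le> fit_gain n x p"
    unfolding isotonic_gain_def
    using assms by (intro cSUP_least) (auto simp: isotonic_fit_def)
  show "fit_gain n x p \<le> isotonic_gain n x"
    using assms by (intro fit_gain_le_isotonic_gain) (simp add: isotonic_fit_def)
qed

lemma continuous_on_fit_gain [continuous_intros]: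
  "continuous_on A (\<lambda>u. fit_gain n x u)" "continuous_on A (\<lambda>x. fit_gain n x u)"
  unfolding fit_gain_def
  by (auto intro!: continuous_intros continuous_on_subset[OF continuous_on_product_coordinates])

lemma fit_gain_clip_le:
  assumes "\<And>i. i < n \<Longrightarrow> \<bar>x i\<bar> \<le> R"
  shows "fit_gain n x u \<le> fit_gain n x (\<lambda>i. max (- R) (min R (u i)))"
  unfolding fit_gain_def
proof (rule sum_mono)
  fix i assume "i \<in> {..<n}"
  then have "\<bar>x i\<bar> \<le> R" using assms by simp
  then have "\<bar>x i - max (- R) (min R (u i))\<bar> \<le> \<bar>x i - u i\<bar>" by auto
  then have "(x i - max (- R) (min R (u i)))\<^sup>2 \<le> (x i - u i)\<^sup>2" by (simp add: abs_le_square_iff)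
  then show "2 * x i * u i - (u i)\<^sup>2
      \<le> 2 * x i * max (- R) (min R (u i)) - (max (- R) (min R (u i)))\<^sup>2"
    by (simp add: power2_diff)
qed

lemma compact_PiE_UNIV:
  fixes K :: "'a \<Rightarrow> 'b::topological_space set"
  assumes "\<And>i. compact (K i)"
  shows "compact (PiE UNIV K)"
proof -
  have "compactin (product_topology (\<lambda>_. euclidean) UNIV) (PiE UNIV K)"
    using assms by (simp add: compactin_PiE)
  then show ?thesis by (simp add: euclidean_product_topology)
qed

lemma closed_Collect_mono_on:
  "closed {u :: 'a::order \<Rightarrow> 'b::linorder_topology. mono_on A u}"
proof -
  have "{u :: 'a \<Rightarrow> 'b. mono_on A u} = (\<Inter>r\<in>A. \<Inter>s\<in>A \<inter> {r..}. {u. u r \<le> u s})"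
    by (auto simp: mono_on_def)
  also have "closed \<dots>"
    by (intro closed_INT ballI closed_Collect_le continuous_on_product_coordinates)
  finally show ?thesis .
qed

lemma isotonic_fit_exists: "\<exists>p. isotonic_fit n x p"
proof -
  define R where "R = (\<Sum>i<n. \<bar>x i\<bar>)"
  have R: "\<bar>x i\<bar> \<le> R" if "i < n" for i
    using that unfolding R_def by (intro member_le_sum) auto
  have "R \<ge> 0" unfolding R_def by (intro sum_nonneg) auto
  define C where "C = PiE UNIV (\<lambda>_::nat. {-R..R}) \<inter> {u. mono_on {..<n} u}"
  have "compact C"
    unfolding C_def by (intro compact_Int_closed compact_PiE_UNIV closed_Collect_mono_on) simp
  moreover have "(\<lambda>_. 0) \<in> C" using \<open>R \<ge> 0\<close> by (auto simp: C_def intro: mono_onI)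
  ultimately obtain p where p: "p \<in> C" "\<And>u. u \<in> C \<Longrightarrow> fit_gain n x u \<le> fit_gain n x p"
    using continuous_attains_sup[of C "fit_gain n x"] continuous_on_fit_gain by blast
  have "fit_gain n x u \<le> fit_gain n x p" if "mono_on {..<n} u" for u
  proof -
    define v where "v i = max (- R) (min R (u i))" for i
    have "mono_on {..<n} v"
      unfolding v_def by (intro mono_onI max.mono min.mono mono_onD[OF that]) auto
    then have "v \<in> C" using \<open>R \<ge> 0\<close> by (auto simp: C_def v_def)
    have "fit_gain n x u \<le> fit_gain n x v"
      unfolding v_def by (rule fit_gain_clip_le[OF R])
    also have "\<dots> \<le> fit_gain n x p" by (rule p(2)[OF \<open>v \<in> C\<close>])
    finally show ?thesis .
  qed
  then show ?thesis using p(1) by (auto simp: C_def isotonic_fit_def)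
qed

lemma borel_measurable_isotonic_gain [measurable]: "isotonic_gain n \<in> borel_measurable borel"
proof (rule borel_measurableI_greater)
  fix c
  have "mono_on {..<n} (\<lambda>_. 0 :: real)" by (intro mono_onI) simp
  then have "{x \<in> space borel. c < isotonic_gain n x}
      = (\<Union>u\<in>{u. mono_on {..<n} u}. {x. c < fit_gain n x u})"
    unfolding isotonic_gain_def using bdd_above_fit_gain by (subst less_cSUP_iff) auto
  moreover have "open \<dots>"
    by (intro open_UN ballI open_Collect_less continuous_intros)
  ultimately show "{x \<in> space borel. c < isotonic_gain n x} \<in> sets borel" by simp
qed

lemma isotonic_fit_variation:
  fixes v :: "nat \<Rightarrow> real"
  assumes fit: "isotonic_fit n x p" and "\<delta> > 0"
    and v: "\<And>e. 0 < e \<Longrightarrow> e < \<delta> \<Longrightarrow> mono_on {..<n} (\<lambda>i. p i + e * v i)"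
  shows "(\<Sum>i<n. (x i - p i) * v i) \<le> 0"
proof (rule ccontr)
  define A where "A = (\<Sum>i<n. (x i - p i) * v i)"
  define B where "B = (\<Sum>i<n. (v i)\<^sup>2)"
  assume "\<not> (\<Sum>i<n. (x i - p i) * v i) \<le> 0"
  then have "A > 0" by (simp add: A_def)
  have "B \<ge> 0" unfolding B_def by (intro sum_nonneg) auto
  define e where "e = min (\<delta> / 2) (A / (B + 1))"
  have e: "0 < e" "e < \<delta>" using \<open>A > 0\<close> \<open>B \<ge> 0\<close> \<open>\<delta> > 0\<close> by (auto simp: e_def)
  have "fit_gain n x (\<lambda>i. p i + e * v i) = fit_gain n x p + (2 * e * A - e\<^sup>2 * B)"
    unfolding fit_gain_def A_def B_def sum_distrib_left sum.distrib[symmetric] sum_subtractf[symmetric]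
    by (intro sum.cong) (auto simp: power2_eq_square algebra_simps)
  moreover have "fit_gain n x (\<lambda>i. p i + e * v i) \<le> fit_gain n x p"
    using fit v[OF e] by (simp add: isotonic_fit_def)
  ultimately have "2 * A \<le> e * B" using e by (simp add: power2_eq_square)
  also have "\<dots> \<le> A / (B + 1) * B" unfolding e_def using \<open>B \<ge> 0\<close> by (intro mult_right_mono) auto
  also have "\<dots> \<le> A" using \<open>B \<ge> 0\<close> \<open>A > 0\<close> by (simp add: field_simps)
  finally show False using \<open>A > 0\<close> by simp
qed

lemma sum_mult_prefix_indicator:
  fixes f :: "nat \<Rightarrow> real"
  assumes "j \<le> n"
  shows "(\<Sum>l<n. f l * (if l < j then c else 0)) = c * (\<Sum>l<j. f l)"
proof -
  have "(\<Sum>l<n. f l * (if l < j then c else 0)) = (\<Sum>l<j. f l * c)"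
    using assms by (intro sum.mono_neutral_cong_right) auto
  then show ?thesis by (simp add: sum_distrib_left mult.commute)
qed

lemma isotonic_fit_residual_nonneg:
  assumes fit: "isotonic_fit n x p" and "j \<le> n"
  shows "0 \<le> (\<Sum>l<j. x l - p l)"
proof -
  have "(\<Sum>l<n. (x l - p l) * (if l < j then -1 else 0)) \<le> 0"
  proof (rule isotonic_fit_variation[OF fit zero_less_one])
    fix e :: real assume "0 < e"
    show "mono_on {..<n} (\<lambda>l. p l + e * (if l < j then -1 else 0))"
    proof (rule mono_onI)
      fix r s assume "r \<in> {..<n}" "s \<in> {..<n}" "r \<le> s"
      then have "p r \<le> p s" using fit by (auto simp: isotonic_fit_def mono_on_def)
      then show "p r + e * (if r < j then -1 else 0) \<le> p s + e * (if s < j then -1 else 0)"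
        using \<open>0 < e\<close> \<open>r \<le> s\<close> by auto
    qed
  qed
  then show ?thesis by (simp add: sum_mult_prefix_indicator[OF \<open>j \<le> n\<close>])
qed

lemma isotonic_fit_residual_eq_0:
  assumes fit: "isotonic_fit n x p" and "j \<le> n" and jump: "\<And>i. i < j \<Longrightarrow> j < n \<Longrightarrow> p i < p j"
  shows "(\<Sum>l<j. x l - p l) = 0"
proof -
  have p: "mono_on {..<n} p" using fit by (simp add: isotonic_fit_def)
  define \<delta> where "\<delta> = (if 0 < j \<and> j < n then p j - p (j - 1) else 1)"
  have "(\<Sum>l<n. (x l - p l) * (if l < j then 1 else 0)) \<le> 0"
  proof (rule isotonic_fit_variation[OF fit])
    show "\<delta> > 0" using jump[of "j - 1"] by (auto simp: \<delta>_def)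
    fix e assume e: "0 < e" "e < \<delta>"
    show "mono_on {..<n} (\<lambda>l. p l + e * (if l < j then 1 else 0))"
    proof (rule mono_onI)
      fix r s assume rs: "r \<in> {..<n}" "s \<in> {..<n}" "r \<le> s"
      show "p r + e * (if r < j then 1 else 0) \<le> p s + e * (if s < j then 1 else 0)"
      proof (cases "r < j \<and> j \<le> s")
        case True
        then have "p r \<le> p (j - 1)" "p j \<le> p s" "0 < j" "j < n"
          using rs by (auto intro!: mono_onD[OF p])
        then show ?thesis using True e by (simp add: \<delta>_def)
      next
        case False
        then show ?thesis using mono_onD[OF p rs] e by auto
      qed
    qed
  qed
  then have "(\<Sum>l<j. x l - p l) \<le> 0"
    using sum_mult_prefix_indicator[OF \<open>j \<le> n\<close>, of "\<lambda>l. x l - p l" 1] by simp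
  then show ?thesis using isotonic_fit_residual_nonneg[OF fit \<open>j \<le> n\<close>] by simp
qed

section \<open>Level blocks\<close>

definition walk :: "real \<Rightarrow> (nat \<Rightarrow> real) \<Rightarrow> nat \<Rightarrow> real" where
  "walk a w j = (\<Sum>l<j. w l - a)"

definition prefix_mean :: "nat \<Rightarrow> (nat \<Rightarrow> real) \<Rightarrow> real" where
  "prefix_mean k w = (\<Sum>l<k. w l) / real k"

definition nonneg_bridge :: "nat \<Rightarrow> (nat \<Rightarrow> real) \<Rightarrow> bool" where
  "nonneg_bridge k w \<longleftrightarrow> (\<forall>j\<in>{..k}. 0 \<le> walk (prefix_mean k w) w j)"

definition strict_argmin :: "nat \<Rightarrow> (nat \<Rightarrow> real) \<Rightarrow> nat \<Rightarrow> bool" where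
  "strict_argmin m f i \<longleftrightarrow> (\<forall>j\<in>{..m}. j \<noteq> i \<longrightarrow> f i < f j)"

definition delete_block :: "nat \<Rightarrow> nat \<Rightarrow> (nat \<Rightarrow> 'a) \<Rightarrow> nat \<Rightarrow> 'a" where
  "delete_block i k w l = (if l < i then w l else w (l + k))"

definition level_block :: "nat \<Rightarrow> (nat \<Rightarrow> real) \<Rightarrow> nat \<Rightarrow> nat \<Rightarrow> bool" where
  "level_block n p i k \<longleftrightarrow> i + k \<le> n \<and> 0 < k \<and>
    (\<forall>l<i. p l < p i) \<and> (\<forall>l<k. p (i + l) = p i) \<and> (\<forall>l\<in>{i + k..<n}. p i < p l)"

lemma walk_Suc: "walk a w (Suc j) = walk a w j + (w j - a)"
  by (simp add: walk_def)

lemma walk_prefix_mean_end: "walk (prefix_mean k w) w k = 0"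
  by (simp add: walk_def prefix_mean_def sum_subtractf)

lemma prefix_mean_eqI: "walk a w k = 0 \<Longrightarrow> 0 < k \<Longrightarrow> prefix_mean k w = a"
  by (simp add: walk_def prefix_mean_def sum_subtractf field_simps)

lemma strict_argmin_unique:
  assumes "strict_argmin m f i" "strict_argmin m f j" "i \<le> m" "j \<le> m"
  shows "i = j"
  using assms by (metis atMost_iff less_asym strict_argmin_def)

lemma strict_argmin_walk_crossing:
  assumes "\<And>l. l < i \<Longrightarrow> q l < a" "\<And>l. i \<le> l \<Longrightarrow> l < m \<Longrightarrow> a < q l"
  shows "strict_argmin m (walk a q) i"
  unfolding strict_argmin_def
proof (intro ballI impI)
  fix j assume j: "j \<in> {..m}" "j \<noteq> i"
  then consider "j < i" | "i < j" "j \<le> m" by fastforce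
  then show "walk a q i < walk a q j"
  proof cases
    case 1
    have "walk a q i = walk a q j + (\<Sum>l\<in>{j..<i}. q l - a)"
      using 1 by (simp add: walk_def lessThan_atLeast0 sum.atLeastLessThan_concat)
    moreover have "(\<Sum>l\<in>{j..<i}. q l - a) < (\<Sum>l\<in>{j..<i}. 0)"
      using 1 assms(1) by (intro sum_strict_mono) auto
    ultimately show ?thesis by simp
  next
    case 2
    have "walk a q j = walk a q i + (\<Sum>l\<in>{i..<j}. q l - a)"
      using 2 by (simp add: walk_def lessThan_atLeast0 sum.atLeastLessThan_concat)
    moreover have "0 < (\<Sum>l\<in>{i..<j}. q l - a)"
      using 2 assms(2) by (intro sum_pos) auto
    ultimately show ?thesis by simp
  qed
qed

lemma sum_delete_block_below: "j \<le> i \<Longrightarrow> (\<Sum>l<j. delete_block i k f l) = (\<Sum>l<j. f l)"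
  by (intro sum.cong) (auto simp: delete_block_def)

lemma sum_delete_block:
  fixes f :: "nat \<Rightarrow> 'a::comm_monoid_add"
  assumes "i \<le> j"
  shows "(\<Sum>l<j + k. f l) = (\<Sum>l<k. f (i + l)) + (\<Sum>l<j. delete_block i k f l)"
  using assms
proof (induction j rule: dec_induct)
  case base
  show ?case
    by (induction k) (simp_all add: delete_block_def ac_simps)
next
  case (step j)
  then show ?case by (simp add: delete_block_def ac_simps)
qed

lemma downward_closed_initial_segment:
  fixes n :: nat
  assumes "\<And>l m. l \<le> m \<Longrightarrow> m < n \<Longrightarrow> P m \<Longrightarrow> P l"
  obtains i where "i \<le> n" "\<And>l. l < n \<Longrightarrow> P l \<longleftrightarrow> l < i"
proof
  define i where "i = (LEAST l. l = n \<or> \<not> P l)"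
  have i: "i = n \<or> \<not> P i" unfolding i_def by (rule LeastI[of _ n]) simp
  show "i \<le> n" unfolding i_def by (rule Least_le) simp
  show "P l \<longleftrightarrow> l < i" if "l < n" for l
    using i assms[of i l] not_less_Least[of l] that unfolding i_def by (metis leI)
qed

lemma level_block_exists:
  assumes p: "mono_on {..<n} p" and "m < n"
  obtains i k where "level_block n p i k" "m \<in> {i..<i + k}"
proof -
  have down: "p l \<le> p r" if "l \<le> r" "r < n" for l r
    using that by (auto intro: mono_onD[OF p])
  obtain i where i: "i \<le> n" "\<And>l. l < n \<Longrightarrow> p l < p m \<longleftrightarrow> l < i"
    by (rule downward_closed_initial_segment[of n "\<lambda>l. p l < p m"]) (auto dest: down)
  obtain j where j: "j \<le> n" "\<And>l. l < n \<Longrightarrow> p l \<le> p m \<longleftrightarrow> l < j"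
    by (rule downward_closed_initial_segment[of n "\<lambda>l. p l \<le> p m"]) (auto dest: down)
  have m: "i \<le> m" "m < j" using i(2)[of m] j(2)[of m] \<open>m < n\<close> by auto
  have level: "p l = p m" if "i \<le> l" "l < j" for l
    using that i(2)[of l] j(1) j(2)[of l] by simp
  have "\<forall>l<j - i. p (i + l) = p m" using level by simp
  moreover have "p i = p m" using level[of i] m by simp
  moreover have "\<forall>l<i. p l < p m" using i by auto
  moreover have "\<forall>l\<in>{j..<n}. p m < p l"
  proof
    fix l assume "l \<in> {j..<n}"
    then show "p m < p l" using j(2)[of l] by simp
  qed
  ultimately have "level_block n p i (j - i)"
    unfolding level_block_def using m j(1) by simp
  then show thesis using that m by simp
qed

context
  fixes n x p i k
  assumes fit: "isotonic_fit n x p" and block: "level_block n p i k"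
begin

private lemma residual_block_start: "(\<Sum>l<i. x l - p l) = 0"
  using block by (intro isotonic_fit_residual_eq_0[OF fit]) (auto simp: level_block_def)

private lemma residual_block_end: "(\<Sum>l<i + k. x l - p l) = 0"
proof (rule isotonic_fit_residual_eq_0[OF fit])
  fix l assume l: "l < i + k" "i + k < n"
  have "p l \<le> p i"
  proof (cases "l < i")
    case True
    then show ?thesis using block by (simp add: level_block_def less_imp_le)
  next
    case False
    then obtain r where "l = i + r" using le_Suc_ex[of i l] by auto
    then show ?thesis using block l by (simp add: level_block_def)
  qed
  also have "p i < p (i + k)" using block l by (simp add: level_block_def)
  finally show "p l < p (i + k)" .
qed (use block in \<open>simp add: level_block_def\<close>)

private lemma walk_block_eq_residual:
  assumes "j \<le> k"
  shows "walk (p i) (\<lambda>l. x (i + l)) j = (\<Sum>l<i + j. x l - p l)"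
proof -
  have "walk (p i) (\<lambda>l. x (i + l)) j = (\<Sum>l<j. x (i + l) - p (i + l))"
    using assms block unfolding walk_def by (intro sum.cong) (auto simp: level_block_def)
  also have "\<dots> = (\<Sum>l<i + j. x l - p l) - (\<Sum>l<i. x l - p l)"
    using sum_delete_block[of i i "\<lambda>l. x l - p l" j] by (simp add: sum_delete_block_below)
  finally show ?thesis by (simp add: residual_block_start)
qed

lemma level_block_prefix_mean: "prefix_mean k (\<lambda>l. x (i + l)) = p i"
proof (rule prefix_mean_eqI)
  show "walk (p i) (\<lambda>l. x (i + l)) k = 0"
    by (simp add: walk_block_eq_residual residual_block_end)
  show "0 < k" using block by (simp add: level_block_def)
qed

lemma level_block_nonneg_bridge: "nonneg_bridge k (\<lambda>l. x (i + l))"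
  unfolding nonneg_bridge_def level_block_prefix_mean
proof
  fix j assume "j \<in> {..k}"
  then have "j \<le> k" "i + j \<le> n" using block by (auto simp: level_block_def)
  then show "0 \<le> walk (p i) (\<lambda>l. x (i + l)) j"
    using isotonic_fit_residual_nonneg[OF fit] by (simp add: walk_block_eq_residual)
qed

lemma level_block_strict_argmin:
  "strict_argmin (n - k) (walk (p i) (delete_block i k x)) i"
  unfolding strict_argmin_def
proof (intro ballI impI)
  fix j assume j: "j \<in> {..n - k}" "j \<noteq> i"
  define r where "r j = (\<Sum>l<j. delete_block i k (\<lambda>l. x l - p l) l)" for j
  have walk: "walk (p i) (delete_block i k x) j = walk (p i) (delete_block i k p) j + r j" for j
    unfolding walk_def r_def sum.distrib[symmetric] by (intro sum.cong) (auto simp: delete_block_def)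
  have "r i = 0" by (simp add: r_def sum_delete_block_below residual_block_start)
  also have "0 \<le> r j"
  proof (cases "j \<le> i")
    case True
    then show ?thesis
      using isotonic_fit_residual_nonneg[OF fit, of j] block
      by (simp add: r_def sum_delete_block_below level_block_def)
  next
    case False
    have "0 \<le> (\<Sum>l<j + k. x l - p l)"
      using j block by (intro isotonic_fit_residual_nonneg[OF fit]) (auto simp: level_block_def)
    also have "\<dots> = (\<Sum>l<i + k. x l - p l) - (\<Sum>l<i. x l - p l) + r j"
      using False sum_delete_block[of i j "\<lambda>l. x l - p l" k] sum_delete_block[of i i "\<lambda>l. x l - p l" k]
      by (simp add: r_def sum_delete_block_below)
    finally show ?thesis by (simp add: residual_block_start residual_block_end)
  qed
  finally have "r i \<le> r j" .
  moreover have "strict_argmin (n - k) (walk (p i) (delete_block i k p)) i"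
    using block by (intro strict_argmin_walk_crossing) (auto simp: delete_block_def level_block_def)
  ultimately show "walk (p i) (delete_block i k x) i < walk (p i) (delete_block i k x) j"
    using j unfolding walk strict_argmin_def by (intro add_less_le_mono) auto
qed

lemma level_block_isotonic_gain_le:
  "isotonic_gain n x \<le> real k * (p i)\<^sup>2 + isotonic_gain (n - k) (delete_block i k x)"
proof -
  define f where "f l = 2 * x l * p l - (p l)\<^sup>2" for l
  have n: "n = n - k + k" "i \<le> n - k" using block by (auto simp: level_block_def)
  have "(\<Sum>l<k. f (i + l)) = (\<Sum>l<k. 2 * p i * (x (i + l) - p i) + (p i)\<^sup>2)"
  proof (intro sum.cong refl)
    fix l assume "l \<in> {..<k}"
    then have "p (i + l) = p i" using block by (simp add: level_block_def)
    then show "f (i + l) = 2 * p i * (x (i + l) - p i) + (p i)\<^sup>2"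
      by (simp add: f_def power2_eq_square algebra_simps)
  qed
  also have "\<dots> = 2 * p i * walk (p i) (\<lambda>l. x (i + l)) k + real k * (p i)\<^sup>2"
    by (simp add: walk_def sum.distrib sum_distrib_left)
  finally have "(\<Sum>l<k. f (i + l)) = real k * (p i)\<^sup>2"
    by (simp add: walk_block_eq_residual residual_block_end)
  moreover have "(\<Sum>l<n - k. delete_block i k f l) \<le> isotonic_gain (n - k) (delete_block i k x)"
  proof -
    have "mono_on {..<n} p" using fit by (simp add: isotonic_fit_def)
    then have "mono_on {..<n - k} (delete_block i k p)"
      using n by (auto simp: mono_on_def delete_block_def)
    then have "fit_gain (n - k) (delete_block i k x) (delete_block i k p)
        \<le> isotonic_gain (n - k) (delete_block i k x)"
      by (rule fit_gain_le_isotonic_gain)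
    also have "fit_gain (n - k) (delete_block i k x) (delete_block i k p)
        = (\<Sum>l<n - k. delete_block i k f l)"
      unfolding fit_gain_def by (intro sum.cong) (auto simp: delete_block_def f_def)
    finally show ?thesis .
  qed
  moreover have "isotonic_gain n x = (\<Sum>l<k. f (i + l)) + (\<Sum>l<n - k. delete_block i k f l)"
    unfolding isotonic_gain_eq_fit_gain[OF fit] fit_gain_def f_def[symmetric]
    using sum_delete_block[OF n(2), of f k] n(1) by simp
  ultimately show ?thesis by simp
qed

end

section \<open>Rearrangements of a sequence\<close>

text \<open>This moves the block \<open>{i..<i + k}\<close> to the front; on \<open>{..<i + k}\<close> it is the cyclic shift by \<open>i\<close>.\<close>

definition block_first :: "nat \<Rightarrow> nat \<Rightarrow> nat \<Rightarrow> nat" where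
  "block_first i k l = (if l < k then i + l else if l < k + i then l - k else l)"

definition reverse_prefix :: "nat \<Rightarrow> nat \<Rightarrow> nat" where
  "reverse_prefix j l = (if l < j then j - 1 - l else l)"

lemma inj_block_first: "inj (block_first i k)"
  by (rule injI) (auto simp: block_first_def split: if_splits)

lemma inj_reverse_prefix: "inj (reverse_prefix j)"
  by (rule injI) (auto simp: reverse_prefix_def split: if_splits)

lemma walk_block_first: "j \<le> k \<Longrightarrow> walk a (w \<circ> block_first i k) j = walk a w (i + j) - walk a w i"
  by (induction j) (simp_all add: walk_Suc block_first_def, simp add: walk_def)

lemma walk_block_first_wrap:
  "j \<le> i \<Longrightarrow> walk a (w \<circ> block_first i k) (k + j) = walk a w (i + k) - walk a w i + walk a w j"
proof (induction j)
  case 0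
  show ?case using walk_block_first[of k k a w i] by (simp add: walk_def)
next
  case (Suc j)
  then show ?case by (simp add: walk_Suc block_first_def)
qed

lemma prefix_mean_block_first: "prefix_mean (i + k) (w \<circ> block_first i k) = prefix_mean (i + k) w"
  using walk_block_first_wrap[of i i 0 w k] by (simp add: walk_def prefix_mean_def add.commute)

lemma nonneg_bridge_shifts_walk_eq:
  assumes "r \<le> k" "q \<le> k"
    and "nonneg_bridge k (w \<circ> block_first r (k - r))" "nonneg_bridge k (w \<circ> block_first q (k - q))"
  shows "walk (prefix_mean k w) w r = walk (prefix_mean k w) w q"
proof -
  define W where "W = walk (prefix_mean k w) w"
  have W_le: "W s \<le> W j"
    if bridge: "nonneg_bridge k (w \<circ> block_first s (k - s))" and "s \<le> k" "j \<le> k" for s j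
  proof -
    have mean: "prefix_mean k (w \<circ> block_first s (k - s)) = prefix_mean k w"
      using prefix_mean_block_first[of s "k - s"] \<open>s \<le> k\<close> by simp
    have pos: "0 \<le> walk (prefix_mean k w) (w \<circ> block_first s (k - s)) m" if "m \<le> k" for m
      using bridge that by (simp add: nonneg_bridge_def mean)
    show "W s \<le> W j"
    proof (cases "s \<le> j")
      case True
      then show ?thesis
        using pos[of "j - s"] \<open>j \<le> k\<close> by (simp add: walk_block_first W_def)
    next
      case False
      then show ?thesis
        using pos[of "k - s + j"] walk_block_first_wrap[of j s "prefix_mean k w" w "k - s"] \<open>s \<le> k\<close>
        by (simp add: W_def walk_prefix_mean_end)
    qed
  qed
  show ?thesis
    using W_le[OF assms(3,1,2)] W_le[OF assms(4,2,1)] by (simp add: W_def)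
qed

definition prefix_determined :: "nat \<Rightarrow> ((nat \<Rightarrow> 'a) \<Rightarrow> 'b) \<Rightarrow> bool" where
  "prefix_determined k F \<longleftrightarrow> (\<forall>w w'. (\<forall>l<k. w l = w' l) \<longrightarrow> F w = F w')"

lemma prefix_determinedI:
  "(\<And>w w'. (\<And>l. l < k \<Longrightarrow> w l = w' l) \<Longrightarrow> F w = F w') \<Longrightarrow> prefix_determined k F"
  unfolding prefix_determined_def by blast

lemma prefix_determinedD:
  "prefix_determined k F \<Longrightarrow> (\<And>l. l < k \<Longrightarrow> w l = w' l) \<Longrightarrow> F w = F w'"
  unfolding prefix_determined_def by blast

lemma prefix_determined_prefix_mean: "prefix_determined k (prefix_mean k)"
  by (intro prefix_determinedI) (simp add: prefix_mean_def)

lemma prefix_determined_nonneg_bridge: "prefix_determined k (nonneg_bridge k)"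
proof (rule prefix_determinedI)
  fix w w' :: "nat \<Rightarrow> real"
  assume eq: "w l = w' l" if "l < k" for l
  have "prefix_mean k w = prefix_mean k w'"
    by (rule prefix_determinedD[OF prefix_determined_prefix_mean eq])
  moreover have "walk a w j = walk a w' j" if "j \<le> k" for a j
    using that eq by (simp add: walk_def)
  ultimately show "nonneg_bridge k w = nonneg_bridge k w'" by (simp add: nonneg_bridge_def)
qed

lemma prefix_determined_isotonic_gain: "prefix_determined n (isotonic_gain n)"
  by (intro prefix_determinedI) (simp add: isotonic_gain_def fit_gain_def)

section \<open>Independent identically distributed real sequences\<close>

lemma measurable_seqI:
  "(\<And>i::nat. (\<lambda>x. f x i) \<in> borel_measurable M) \<Longrightarrow> f \<in> M \<rightarrow>\<^sub>M (borel :: (nat \<Rightarrow> real) measure)"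
  by (rule measurable_coordinatewise_then_product)

lemma measurable_seq_comp [measurable]:
  fixes f :: "nat \<Rightarrow> nat"
  shows "(\<lambda>w. w \<circ> f) \<in> (borel :: (nat \<Rightarrow> real) measure) \<rightarrow>\<^sub>M borel"
  by (rule measurable_seqI) simp

lemma measurable_seq_shift [measurable]:
  "(\<lambda>w l. w (k + l)) \<in> (borel :: (nat \<Rightarrow> real) measure) \<rightarrow>\<^sub>M borel"
  by (rule measurable_seqI) simp

lemma measurable_delete_block [measurable]:
  "delete_block i k \<in> (borel :: (nat \<Rightarrow> real) measure) \<rightarrow>\<^sub>M borel"
  by (rule measurable_seqI) (simp add: delete_block_def)

lemma borel_measurable_prefix_mean [measurable]: "prefix_mean k \<in> borel_measurable borel"
  unfolding prefix_mean_def by measurable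

lemma borel_measurable_walk [measurable (raw)]:
  assumes [measurable]: "a \<in> borel_measurable M" "w \<in> borel_measurable M"
  shows "(\<lambda>x. walk (a x) (w x) j) \<in> borel_measurable M"
proof -
  have [measurable]: "(\<lambda>x. w x l) \<in> borel_measurable M" for l
    by (rule measurable_compose[OF assms(2) measurable_product_coordinates])
  show ?thesis unfolding walk_def by measurable
qed

lemma pred_nonneg_bridge [measurable]: "Measurable.pred borel (nonneg_bridge k)"
  unfolding nonneg_bridge_def by measurable

lemma sum_of_bool_le_1:
  assumes "finite A" and "\<And>i j. i \<in> A \<Longrightarrow> j \<in> A \<Longrightarrow> P i \<Longrightarrow> P j \<Longrightarrow> i = j"
  shows "(\<Sum>i\<in>A. of_bool (P i)) \<le> (1 :: 'a::linordered_nonzero_semiring)"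
proof -
  have "card (A \<inter> Collect P) \<le> Suc 0"
    using assms by (subst card_le_Suc0_iff_eq) auto
  then have "(of_nat (card (A \<inter> Collect P)) :: 'a) \<le> of_nat (Suc 0)" by (rule of_nat_mono)
  then show ?thesis using \<open>finite A\<close> by simp
qed

locale real_sequence_space = sequence_space M for M :: "real measure" +
  assumes sets_M: "sets M = sets borel"
begin

lemma sets_S [measurable_cong]: "sets S = sets borel"
proof -
  have "sets S = sets (PiM UNIV (\<lambda>_::nat. borel :: real measure))"
    by (intro sets_PiM_cong) (auto simp: sets_M)
  then show ?thesis using sets_PiM_equal_borel by simp
qed

lemma nn_integral_reindex:
  assumes "inj f" and [measurable]: "F \<in> borel_measurable borel"
  shows "(\<integral>\<^sup>+w. F (w \<circ> f) \<partial>S) = (\<integral>\<^sup>+w. F w \<partial>S)"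
proof -
  have [measurable]: "(\<lambda>w. w \<circ> f) \<in> S \<rightarrow>\<^sub>M S"
    by (simp add: measurable_cong_sets[OF sets_S sets_S] measurable_seq_comp)
  have "distr S S (\<lambda>w. w \<circ> f) = S"
    using distr_PiM_reindex[of UNIV "\<lambda>_. M" f UNIV] \<open>inj f\<close> M.prob_space_axioms
    by (simp add: comp_def restrict_UNIV)
  then have "(\<integral>\<^sup>+w. F w \<partial>S) = (\<integral>\<^sup>+w. F w \<partial>distr S S (\<lambda>w. w \<circ> f))" by simp
  also have "\<dots> = (\<integral>\<^sup>+w. F (w \<circ> f) \<partial>S)" by (subst nn_integral_distr) auto
  finally show ?thesis by simp
qed

lemma nn_integral_comb_seq:
  assumes [measurable]: "F \<in> borel_measurable S"
  shows "(\<integral>\<^sup>+w. F w \<partial>S) = (\<integral>\<^sup>+y. \<integral>\<^sup>+h. F (comb_seq k y h) \<partial>S \<partial>S)"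
proof -
  have "(\<integral>\<^sup>+w. F w \<partial>S) = (\<integral>\<^sup>+w. F w \<partial>distr (S \<Otimes>\<^sub>M S) S (\<lambda>(y, h). comb_seq k y h))"
    by (simp only: PiM_comb_seq)
  also have "\<dots> = (\<integral>\<^sup>+(y, h). F (comb_seq k y h) \<partial>(S \<Otimes>\<^sub>M S))"
    by (subst nn_integral_distr) (auto intro: measurable_comb_seq simp: split_beta')
  also have "\<dots> = (\<integral>\<^sup>+y. \<integral>\<^sup>+h. F (comb_seq k y h) \<partial>S \<partial>S)"
    by (subst P.nn_integral_fst[symmetric]) (auto simp: split_beta')
  finally show ?thesis .
qed

lemma nn_integral_delete_block:
  assumes [measurable]: "case_prod G \<in> borel_measurable (borel \<Otimes>\<^sub>M borel)"
    and G: "\<And>h. prefix_determined k (\<lambda>y. G y h)"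
  shows "(\<integral>\<^sup>+w. G (\<lambda>l. w (i + l)) (delete_block i k w) \<partial>S) = (\<integral>\<^sup>+y. \<integral>\<^sup>+h. G y h \<partial>S \<partial>S)"
proof -
  define F where "F w = G w (\<lambda>l. w (k + l))" for w
  have [measurable]: "F \<in> borel_measurable borel" unfolding F_def by measurable
  have "G (\<lambda>l. w (i + l)) (delete_block i k w) = F (w \<circ> block_first i k)" for w
  proof -
    have "G (\<lambda>l. w (i + l)) h = G (w \<circ> block_first i k) h" for h
      by (rule prefix_determinedD[OF G]) (simp add: block_first_def)
    moreover have "delete_block i k w = (\<lambda>l. (w \<circ> block_first i k) (k + l))"
      by (auto simp: delete_block_def block_first_def add.commute)
    ultimately show ?thesis by (simp add: F_def)
  qed
  then have "(\<integral>\<^sup>+w. G (\<lambda>l. w (i + l)) (delete_block i k w) \<partial>S) = (\<integral>\<^sup>+w. F w \<partial>S)"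
    by (simp add: nn_integral_reindex[OF inj_block_first])
  also have "\<dots> = (\<integral>\<^sup>+y. \<integral>\<^sup>+h. F (comb_seq k y h) \<partial>S \<partial>S)"
    by (rule nn_integral_comb_seq) measurable
  also have "\<dots> = (\<integral>\<^sup>+y. \<integral>\<^sup>+h. G y h \<partial>S \<partial>S)"
  proof (intro nn_integral_cong)
    fix y h
    have "G (comb_seq k y h) h = G y h"
      by (rule prefix_determinedD[OF G]) (simp add: comb_seq_def)
    then show "F (comb_seq k y h) = G y h" by (simp add: F_def comb_seq_def)
  qed
  finally show ?thesis .
qed

end

locale atomless_sequence_space = real_sequence_space +
  assumes AE_neq: "AE x in M. x \<noteq> c"
begin

lemma AE_coordinate_neq: "AE w in S. w i \<noteq> c"
  by (rule AE_PiM_component[of UNIV "\<lambda>_. M" i "\<lambda>x. x \<noteq> c"]) (auto intro: M.prob_space_axioms AE_neq)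

lemma AE_walk_neq:
  assumes "r < q" "q < k"
  shows "AE w in S. walk (prefix_mean k w) w r \<noteq> walk (prefix_mean k w) w q"
proof -
  \<comment> \<open>Conditionally on the other coordinates, the last one is determined by the equation.\<close>
  define m where "m = k - 1"
  have k: "k = Suc m" and q: "q \<le> m" using assms by (auto simp: m_def)
  define B where "B = {w. walk (prefix_mean k w) w r = walk (prefix_mean k w) w q}"
  have "{w \<in> space borel. walk (prefix_mean k w) w r = walk (prefix_mean k w) w q} \<in> sets borel"
    by measurable
  then have [measurable]: "B \<in> sets borel" by (simp add: B_def)
  have "(\<integral>\<^sup>+h. indicator B (comb_seq m y h) \<partial>S) = 0" for y
  proof -
    define c where "c = ((\<Sum>l<q. y l) - (\<Sum>l<r. y l)) * real k / real (q - r) - (\<Sum>l<m. y l)"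
    have "h 0 = c" if "comb_seq m y h \<in> B" for h
    proof -
      have "(\<Sum>l<j. comb_seq m y h l) = (\<Sum>l<j. y l)" if "j \<le> m" for j
        using that by (simp add: comb_seq_def)
      moreover have "prefix_mean k (comb_seq m y h) = ((\<Sum>l<m. y l) + h 0) / real k"
        by (simp add: k prefix_mean_def comb_seq_def)
      ultimately have "(\<Sum>l<q. y l) - (\<Sum>l<r. y l) = real (q - r) * (((\<Sum>l<m. y l) + h 0) / real k)"
        using that assms q
        by (simp add: B_def walk_def sum_subtractf of_nat_diff left_diff_distrib diff_divide_distrib)
      then show ?thesis using assms k unfolding c_def by (simp add: field_simps)
    qed
    then have "AE h in S. indicator B (comb_seq m y h) = (0::ennreal)"
      using AE_coordinate_neq[of 0 c] by (auto elim!: eventually_mono simp: indicator_def)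
    then have "(\<integral>\<^sup>+h. indicator B (comb_seq m y h) \<partial>S) = (\<integral>\<^sup>+h. 0 \<partial>S)"
      by (rule nn_integral_cong_AE)
    then show ?thesis by simp
  qed
  then have "(\<integral>\<^sup>+w. indicator B w \<partial>S) = 0"
    by (subst nn_integral_comb_seq[of _ m]) auto
  then have "AE w in S. indicator B w = (0::ennreal)"
    by (subst (asm) nn_integral_0_iff_AE) auto
  then show ?thesis by (auto elim!: eventually_mono simp: B_def indicator_def split: if_splits)
qed

lemma AE_at_most_one_nonneg_bridge_shift:
  "AE w in S. (\<Sum>r<k. of_bool (nonneg_bridge k (w \<circ> block_first r (k - r)))) \<le> (1::ennreal)"
proof -
  have "AE w in S. \<forall>r\<in>{..<k}. \<forall>q\<in>{..<k}. r < q \<longrightarrow>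
      walk (prefix_mean k w) w r \<noteq> walk (prefix_mean k w) w q"
    using AE_walk_neq by (intro AE_finite_allI finite_lessThan AE_impI) auto
  then show ?thesis
  proof eventually_elim
    case (elim w)
    then have inj: "inj_on (walk (prefix_mean k w) w) {..<k}"
      by (intro linorder_inj_onI) auto
    show ?case
    proof (rule sum_of_bool_le_1)
      fix r q assume "r \<in> {..<k}" "q \<in> {..<k}"
        and "nonneg_bridge k (w \<circ> block_first r (k - r))" "nonneg_bridge k (w \<circ> block_first q (k - q))"
      then show "r = q"
        using inj_onD[OF inj] nonneg_bridge_shifts_walk_eq[of r k q w] by simp
    qed simp
  qed
qed

lemma nn_integral_nonneg_bridge_le:
  fixes \<phi> :: "real \<Rightarrow> ennreal"
  assumes [measurable]: "\<phi> \<in> borel_measurable borel"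
  shows "of_nat k * (\<integral>\<^sup>+w. of_bool (nonneg_bridge k w) * \<phi> (prefix_mean k w) \<partial>S)
    \<le> (\<integral>\<^sup>+w. \<phi> (prefix_mean k w) \<partial>S)"
proof -
  define f where "f w = of_bool (nonneg_bridge k w) * \<phi> (prefix_mean k w)" for w
  have [measurable]: "f \<in> borel_measurable borel" unfolding f_def by measurable
  have shift: "f (w \<circ> block_first r (k - r))
      = of_bool (nonneg_bridge k (w \<circ> block_first r (k - r))) * \<phi> (prefix_mean k w)"
    if "r < k" for w r
    using prefix_mean_block_first[of r "k - r" w] that by (simp add: f_def)
  have "of_nat k * (\<integral>\<^sup>+w. f w \<partial>S) = (\<Sum>r<k. \<integral>\<^sup>+w. f (w \<circ> block_first r (k - r)) \<partial>S)"
    by (simp add: nn_integral_reindex[OF inj_block_first])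
  also have "\<dots> = (\<integral>\<^sup>+w. (\<Sum>r<k. f (w \<circ> block_first r (k - r))) \<partial>S)"
    by (rule nn_integral_sum[symmetric]) measurable
  also have "\<dots> \<le> (\<integral>\<^sup>+w. \<phi> (prefix_mean k w) \<partial>S)"
  proof (rule nn_integral_mono_AE, use AE_at_most_one_nonneg_bridge_shift[of k] in eventually_elim)
    case (elim w)
    have "(\<Sum>r<k. f (w \<circ> block_first r (k - r)))
        = (\<Sum>r<k. of_bool (nonneg_bridge k (w \<circ> block_first r (k - r)))) * \<phi> (prefix_mean k w)"
      unfolding sum_distrib_right by (intro sum.cong refl shift) simp
    also have "\<dots> \<le> 1 * \<phi> (prefix_mean k w)" by (intro mult_right_mono elim) simp
    finally show ?case by simp
  qed
  finally show ?thesis unfolding f_def .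
qed

end

section \<open>Exponential moments of the isotonic gain\<close>

definition exp_gain :: "real \<Rightarrow> nat \<Rightarrow> (nat \<Rightarrow> real) \<Rightarrow> ennreal" where
  "exp_gain t n w = ennreal (exp (t * isotonic_gain n w))"

definition exp_mean :: "real \<Rightarrow> nat \<Rightarrow> (nat \<Rightarrow> real) \<Rightarrow> ennreal" where
  "exp_mean t k w = ennreal (exp (t * (real k * (prefix_mean k w)\<^sup>2)))"

definition split_weight :: "real \<Rightarrow> nat \<Rightarrow> nat \<Rightarrow> nat \<Rightarrow> (nat \<Rightarrow> real) \<Rightarrow> (nat \<Rightarrow> real) \<Rightarrow> ennreal" where
  "split_weight t n k i y h =
    of_bool (nonneg_bridge k y) * of_bool (strict_argmin (n - k) (walk (prefix_mean k y) h) i)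
      * (exp_mean t k y * exp_gain t (n - k) h)"

lemma borel_measurable_exp_gain [measurable]: "exp_gain t n \<in> borel_measurable borel"
  unfolding exp_gain_def by measurable

lemma borel_measurable_exp_mean [measurable]: "exp_mean t k \<in> borel_measurable borel"
  unfolding exp_mean_def by measurable

lemma borel_measurable_split_weight [measurable]:
  "case_prod (split_weight t n k i) \<in> borel_measurable (borel \<Otimes>\<^sub>M borel)"
  unfolding split_weight_def strict_argmin_def by measurable

lemma prefix_determined_exp_gain: "prefix_determined n (exp_gain t n)"
  unfolding exp_gain_def
  by (intro prefix_determinedI) (metis prefix_determinedD[OF prefix_determined_isotonic_gain])

lemma prefix_determined_split_weight: "prefix_determined k (\<lambda>y. split_weight t n k i y h)"
proof (rule prefix_determinedI)
  fix y y' :: "nat \<Rightarrow> real"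
  assume eq: "y l = y' l" if "l < k" for l
  have "prefix_mean k y = prefix_mean k y'"
    by (rule prefix_determinedD[OF prefix_determined_prefix_mean eq])
  moreover have "nonneg_bridge k y = nonneg_bridge k y'"
    by (rule prefix_determinedD[OF prefix_determined_nonneg_bridge eq])
  ultimately show "split_weight t n k i y h = split_weight t n k i y' h"
    by (simp add: split_weight_def exp_mean_def)
qed

lemma exp_gain_0: "exp_gain t 0 w = 1"
  by (simp add: exp_gain_def isotonic_gain_def fit_gain_def)

lemma exp_gain_le_split_weight:
  assumes "0 \<le> t" and fit: "isotonic_fit n x p" and block: "level_block n p i k"
  shows "exp_gain t n x \<le> split_weight t n k i (\<lambda>l. x (i + l)) (delete_block i k x)"
proof -
  have "exp_gain t n x
      \<le> ennreal (exp (t * (real k * (p i)\<^sup>2) + t * isotonic_gain (n - k) (delete_block i k x)))"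
    unfolding exp_gain_def distrib_left[symmetric]
    by (simp add: mult_left_mono level_block_isotonic_gain_le[OF fit block] \<open>0 \<le> t\<close>)
  also have "\<dots> = split_weight t n k i (\<lambda>l. x (i + l)) (delete_block i k x)"
    using level_block_nonneg_bridge[OF fit block] level_block_strict_argmin[OF fit block]
    by (simp add: split_weight_def exp_gain_def exp_mean_def level_block_prefix_mean[OF fit block]
        exp_add ennreal_mult)
  finally show ?thesis .
qed

text \<open>The blocks of the isotonic fit cover \<open>{..<n}\<close>, so their lengths add up to \<open>n\<close>.\<close>

lemma of_nat_mult_exp_gain_le:
  assumes "0 \<le> t"
  shows "of_nat n * exp_gain t n x
    \<le> (\<Sum>k\<in>{1..n}. \<Sum>i\<le>n-k. of_nat k * split_weight t n k i (\<lambda>l. x (i + l)) (delete_block i k x))"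
proof -
  define T where "T = (\<lambda>(k, i). split_weight t n k i (\<lambda>l. x (i + l)) (delete_block i k x))"
  define B where "B = (SIGMA k:{1..n}. {..n-k})"
  obtain p where fit: "isotonic_fit n x p" using isotonic_fit_exists by blast
  have "exp_gain t n x \<le> (\<Sum>(k, i)\<in>B. of_bool (m \<in> {i..<i + k}) * T (k, i))" if m: "m < n" for m
  proof -
    have "mono_on {..<n} p" using fit by (simp add: isotonic_fit_def)
    then obtain i k where block: "level_block n p i k" and mem: "m \<in> {i..<i + k}"
      using level_block_exists m by metis
    have B: "finite B" "(k, i) \<in> B" using block by (auto simp: B_def level_block_def)
    have "exp_gain t n x \<le> of_bool (m \<in> {i..<i + k}) * T (k, i)"
      using exp_gain_le_split_weight[OF assms fit block] mem by (simp add: T_def)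
    also have "\<dots> \<le> (\<Sum>(k, i)\<in>B. of_bool (m \<in> {i..<i + k}) * T (k, i))"
      using member_le_sum[OF B(2) _ B(1), of "\<lambda>(k, i). of_bool (m \<in> {i..<i + k}) * T (k, i)"] by simp
    finally show ?thesis .
  qed
  then have "(\<Sum>m<n. exp_gain t n x) \<le> (\<Sum>m<n. \<Sum>(k, i)\<in>B. of_bool (m \<in> {i..<i + k}) * T (k, i))"
    by (intro sum_mono) simp
  also have "\<dots> = (\<Sum>(k, i)\<in>B. (\<Sum>m<n. of_bool (m \<in> {i..<i + k})) * T (k, i))"
    by (subst sum.swap) (simp add: split_beta' sum_distrib_right)
  also have "\<dots> = (\<Sum>(k, i)\<in>B. of_nat k * T (k, i))"
  proof (intro sum.cong refl, clarify)
    fix k i assume "(k, i) \<in> B"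
    then have "{..<n} \<inter> {m. m \<in> {i..<i + k}} = {i..<i + k}" by (auto simp: B_def)
    then show "(\<Sum>m<n. of_bool (m \<in> {i..<i + k})) * T (k, i) = of_nat k * T (k, i)"
      by simp
  qed
  also have "\<dots> = (\<Sum>k\<in>{1..n}. \<Sum>i\<le>n-k. of_nat k * T (k, i))"
    unfolding B_def by (rule sum.Sigma[symmetric]) auto
  finally show ?thesis by (simp add: T_def)
qed

lemma sum_split_weight_le:
  "(\<Sum>i\<le>n-k. split_weight t n k i y h)
    \<le> of_bool (nonneg_bridge k y) * exp_mean t k y * exp_gain t (n - k) h"
proof -
  let ?argmin = "\<lambda>i. strict_argmin (n - k) (walk (prefix_mean k y) h) i"
  let ?weight = "of_bool (nonneg_bridge k y) * exp_mean t k y * exp_gain t (n - k) h"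
  have "(\<Sum>i\<le>n-k. split_weight t n k i y h) = (\<Sum>i\<le>n-k. of_bool (?argmin i)) * ?weight"
    unfolding split_weight_def sum_distrib_right by (intro sum.cong refl) (simp only: ac_simps)
  also have "\<dots> \<le> 1 * ?weight"
    by (intro mult_right_mono sum_of_bool_le_1) (auto intro: strict_argmin_unique)
  finally show ?thesis by simp
qed

definition valley_weight :: "real \<Rightarrow> nat \<Rightarrow> (nat \<Rightarrow> real) \<Rightarrow> ennreal" where
  "valley_weight t n w =
    (\<Sum>j\<le>n. exp_gain t j (w \<circ> reverse_prefix j) * exp_gain t (n - j) (delete_block 0 j w))"

lemma borel_measurable_valley_weight [measurable]: "valley_weight t n \<in> borel_measurable borel"
  unfolding valley_weight_def by measurable

lemma prefix_determined_exp_gain_reverse: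
  "prefix_determined j (\<lambda>w. exp_gain t j (w \<circ> reverse_prefix j))"
proof (rule prefix_determinedI)
  fix w w' :: "nat \<Rightarrow> real"
  assume "w l = w' l" if "l < j" for l
  then show "exp_gain t j (w \<circ> reverse_prefix j) = exp_gain t j (w' \<circ> reverse_prefix j)"
    by (intro prefix_determinedD[OF prefix_determined_exp_gain]) (simp add: reverse_prefix_def)
qed

lemma prefix_determined_valley_weight: "prefix_determined n (valley_weight t n)"
proof (rule prefix_determinedI)
  fix w w' :: "nat \<Rightarrow> real"
  assume eq: "w l = w' l" if "l < n" for l
  show "valley_weight t n w = valley_weight t n w'"
    unfolding valley_weight_def
  proof (rule sum.cong[OF refl])
    fix j assume "j \<in> {..n}"
    then have "exp_gain t j (w \<circ> reverse_prefix j) = exp_gain t j (w' \<circ> reverse_prefix j)"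
      by (intro prefix_determinedD[OF prefix_determined_exp_gain_reverse] eq) simp
    moreover have "exp_gain t (n - j) (delete_block 0 j w) = exp_gain t (n - j) (delete_block 0 j w')"
      by (intro prefix_determinedD[OF prefix_determined_exp_gain]) (simp add: delete_block_def eq)
    ultimately show "exp_gain t j (w \<circ> reverse_prefix j) * exp_gain t (n - j) (delete_block 0 j w)
        = exp_gain t j (w' \<circ> reverse_prefix j) * exp_gain t (n - j) (delete_block 0 j w')"
      by simp
  qed
qed

lemma (in real_sequence_space) nn_integral_valley_weight:
  "(\<integral>\<^sup>+w. valley_weight t n w \<partial>S)
    = (\<Sum>j\<le>n. (\<integral>\<^sup>+w. exp_gain t j w \<partial>S) * (\<integral>\<^sup>+w. exp_gain t (n - j) w \<partial>S))"
proof -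
  have "(\<integral>\<^sup>+w. exp_gain t j (w \<circ> reverse_prefix j) * exp_gain t (n - j) (delete_block 0 j w) \<partial>S)
      = (\<integral>\<^sup>+w. exp_gain t j w \<partial>S) * (\<integral>\<^sup>+w. exp_gain t (n - j) w \<partial>S)" for j
  proof -
    have det: "prefix_determined j (\<lambda>y. exp_gain t j (y \<circ> reverse_prefix j) * c)" for c
      by (intro prefix_determinedI) (metis prefix_determinedD[OF prefix_determined_exp_gain_reverse])
    have "(\<integral>\<^sup>+w. exp_gain t j (w \<circ> reverse_prefix j) * exp_gain t (n - j) (delete_block 0 j w) \<partial>S)
        = (\<integral>\<^sup>+y. \<integral>\<^sup>+h. exp_gain t j (y \<circ> reverse_prefix j) * exp_gain t (n - j) h \<partial>S \<partial>S)"
      using nn_integral_delete_block[OF _ det, of "\<lambda>h. exp_gain t (n - j) h" 0] by simp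
    also have "\<dots> = (\<integral>\<^sup>+y. exp_gain t j (y \<circ> reverse_prefix j) \<partial>S) * (\<integral>\<^sup>+h. exp_gain t (n - j) h \<partial>S)"
      by (simp add: nn_integral_cmult nn_integral_multc)
    also have "(\<integral>\<^sup>+y. exp_gain t j (y \<circ> reverse_prefix j) \<partial>S) = (\<integral>\<^sup>+y. exp_gain t j y \<partial>S)"
      by (rule nn_integral_reindex[OF inj_reverse_prefix]) measurable
    finally show ?thesis .
  qed
  then show ?thesis
    unfolding valley_weight_def by (subst nn_integral_sum) simp_all
qed

context atomless_sequence_space
begin

lemma nn_integral_nonneg_bridge_exp_mean_le:
  "of_nat k * (\<integral>\<^sup>+y. of_bool (nonneg_bridge k y) * exp_mean t k y \<partial>S) \<le> (\<integral>\<^sup>+y. exp_mean t k y \<partial>S)"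
  unfolding exp_mean_def by (intro nn_integral_nonneg_bridge_le) measurable

lemma nn_integral_split_weight_le:
  "of_nat k * (\<Sum>i\<le>n-k. \<integral>\<^sup>+x. split_weight t n k i (\<lambda>l. x (i + l)) (delete_block i k x) \<partial>S)
    \<le> (\<integral>\<^sup>+y. exp_mean t k y \<partial>S) * (\<integral>\<^sup>+h. exp_gain t (n - k) h \<partial>S)"
proof -
  let ?bridge = "\<lambda>y. of_bool (nonneg_bridge k y) * exp_mean t k y"
  have "(\<Sum>i\<le>n-k. \<integral>\<^sup>+x. split_weight t n k i (\<lambda>l. x (i + l)) (delete_block i k x) \<partial>S)
      = (\<Sum>i\<le>n-k. \<integral>\<^sup>+y. \<integral>\<^sup>+h. split_weight t n k i y h \<partial>S \<partial>S)"
    by (intro sum.cong refl nn_integral_delete_block prefix_determined_split_weight) simp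
  also have "\<dots> = (\<integral>\<^sup>+y. \<integral>\<^sup>+h. (\<Sum>i\<le>n-k. split_weight t n k i y h) \<partial>S \<partial>S)"
    by (simp add: nn_integral_sum)
  also have "\<dots> \<le> (\<integral>\<^sup>+y. \<integral>\<^sup>+h. ?bridge y * exp_gain t (n - k) h \<partial>S \<partial>S)"
    by (intro nn_integral_mono sum_split_weight_le)
  also have "\<dots> = (\<integral>\<^sup>+y. ?bridge y \<partial>S) * (\<integral>\<^sup>+h. exp_gain t (n - k) h \<partial>S)"
    by (simp add: nn_integral_cmult nn_integral_multc)
  finally have "of_nat k
        * (\<Sum>i\<le>n-k. \<integral>\<^sup>+x. split_weight t n k i (\<lambda>l. x (i + l)) (delete_block i k x) \<partial>S)
      \<le> (of_nat k * (\<integral>\<^sup>+y. ?bridge y \<partial>S)) * (\<integral>\<^sup>+h. exp_gain t (n - k) h \<partial>S)"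
    by (simp add: mult_left_mono mult.assoc)
  also have "\<dots> \<le> (\<integral>\<^sup>+y. exp_mean t k y \<partial>S) * (\<integral>\<^sup>+h. exp_gain t (n - k) h \<partial>S)"
    by (intro mult_right_mono nn_integral_nonneg_bridge_exp_mean_le) simp
  finally show ?thesis .
qed

lemma nn_integral_exp_gain_recursion:
  assumes "0 \<le> t"
  shows "of_nat n * (\<integral>\<^sup>+x. exp_gain t n x \<partial>S)
    \<le> (\<Sum>k\<in>{1..n}. (\<integral>\<^sup>+y. exp_mean t k y \<partial>S) * (\<integral>\<^sup>+x. exp_gain t (n - k) x \<partial>S))"
proof -
  let ?W = "\<lambda>k i x. split_weight t n k i (\<lambda>l. x (i + l)) (delete_block i k x)"
  have [measurable]: "?W k i \<in> borel_measurable borel" for k i by measurable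
  have "of_nat n * (\<integral>\<^sup>+x. exp_gain t n x \<partial>S) = (\<integral>\<^sup>+x. of_nat n * exp_gain t n x \<partial>S)"
    by (simp add: nn_integral_cmult)
  also have "\<dots> \<le> (\<integral>\<^sup>+x. (\<Sum>k\<in>{1..n}. \<Sum>i\<le>n-k. of_nat k * ?W k i x) \<partial>S)"
    by (intro nn_integral_mono of_nat_mult_exp_gain_le assms)
  also have "\<dots> = (\<Sum>k\<in>{1..n}. of_nat k * (\<Sum>i\<le>n-k. \<integral>\<^sup>+x. ?W k i x \<partial>S))"
    by (simp add: nn_integral_sum nn_integral_cmult sum_distrib_left)
  also have "\<dots> \<le> (\<Sum>k\<in>{1..n}. (\<integral>\<^sup>+y. exp_mean t k y \<partial>S) * (\<integral>\<^sup>+x. exp_gain t (n - k) x \<partial>S))"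
    by (intro sum_mono nn_integral_split_weight_le)
  finally show ?thesis .
qed

end

section \<open>Gaussian sequences\<close>

abbreviation std_normal :: "real measure" where
  "std_normal \<equiv> density lborel (\<lambda>x. ennreal (std_normal_density x))"

interpretation std_normal: atomless_sequence_space std_normal
proof -
  interpret prob_space std_normal by (simp add: prob_space_normal_density)
  show "atomless_sequence_space std_normal"
  proof unfold_locales
    show "AE x in std_normal. x \<noteq> c" for c
      by (subst AE_density) (auto intro: AE_mp[OF AE_lborel_singleton])
  qed simp
qed

abbreviation gauss_seq :: "(nat \<Rightarrow> real) measure" where
  "gauss_seq \<equiv> PiM UNIV (\<lambda>_. std_normal)"

lemma (in product_prob_space) indep_vars_coordinates:
  assumes "J \<noteq> {}" "J \<subseteq> I"
  shows "indep_vars M (\<lambda>i w. w i) J"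
proof (subst indep_vars_iff_distr_eq_PiM')
  have "distr (PiM I M) (PiM J M) (\<lambda>w. \<lambda>i\<in>J. w i) = PiM J M"
    using distr_PiM_reindex[of I M "\<lambda>i. i" J] M.prob_space_axioms assms by auto
  also have "\<dots> = (\<Pi>\<^sub>M i\<in>J. distr (PiM I M) (M i) (\<lambda>w. w i))"
    using assms by (intro PiM_cong refl) (auto simp: PiM_component)
  finally show "distr (PiM I M) (PiM J M) (\<lambda>w. \<lambda>i\<in>J. w i)
      = (\<Pi>\<^sub>M i\<in>J. distr (PiM I M) (M i) (\<lambda>w. w i))" .
qed (use assms in auto)

lemma distributed_sum_gauss_seq:
  assumes "k > 0"
  shows "distributed gauss_seq lborel (\<lambda>w. \<Sum>l<k. w l) (normal_density 0 (sqrt (real k)))"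
proof -
  have "std_normal.indep_vars (\<lambda>_. borel) (\<lambda>i w. w i) {..<k}"
    using assms by (intro std_normal.indep_vars_compose2[OF std_normal.indep_vars_coordinates]) auto
  moreover have "distributed gauss_seq lborel (\<lambda>w. w i) (normal_density 0 1)" for i
  proof -
    have "distr gauss_seq lborel (\<lambda>w. w i) = distr gauss_seq std_normal (\<lambda>w. w i)"
      by (rule distr_cong) auto
    also have "\<dots> = std_normal" by (rule std_normal.PiM_component) simp
    finally show ?thesis by (simp add: distributed_def)
  qed
  ultimately have "distributed gauss_seq lborel (\<lambda>w. \<Sum>l<k. w l)
      (normal_density (\<Sum>l<k. 0) (sqrt (\<Sum>l<k. 1\<^sup>2)))"
    using assms by (intro std_normal.sum_indep_normal) auto
  then show ?thesis by simp
qed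

lemma nn_integral_exp_square_normal:
  assumes "\<sigma> > 0" and "2 * t * \<sigma>\<^sup>2 < 1"
  shows "(\<integral>\<^sup>+s. ennreal (normal_density 0 \<sigma> s) * ennreal (exp (t * s\<^sup>2)) \<partial>lborel)
    = ennreal (1 / sqrt (1 - 2 * t * \<sigma>\<^sup>2))"
proof -
  define c where "c = 1 - 2 * t * \<sigma>\<^sup>2"
  have "c > 0" using assms by (simp add: c_def)
  define \<tau> where "\<tau> = \<sigma> / sqrt c"
  have "\<tau> > 0" and \<tau>: "\<tau>\<^sup>2 = \<sigma>\<^sup>2 / c" using \<open>c > 0\<close> \<open>\<sigma> > 0\<close> by (simp_all add: \<tau>_def power_divide)
  have "normal_density 0 \<sigma> s * exp (t * s\<^sup>2) = 1 / sqrt c * normal_density 0 \<tau> s" for s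
  proof -
    have "- s\<^sup>2 / (2 * \<sigma>\<^sup>2) + t * s\<^sup>2 = - s\<^sup>2 / (2 * \<tau>\<^sup>2)"
      using \<open>c > 0\<close> \<open>\<sigma> > 0\<close> unfolding \<tau> by (simp add: c_def field_simps)
    then have "exp (- s\<^sup>2 / (2 * \<sigma>\<^sup>2)) * exp (t * s\<^sup>2) = exp (- s\<^sup>2 / (2 * \<tau>\<^sup>2))"
      by (simp only: exp_add[symmetric])
    moreover have "sqrt (2 * pi * \<tau>\<^sup>2) = sqrt (2 * pi * \<sigma>\<^sup>2) / sqrt c"
      unfolding \<tau> by (simp add: real_sqrt_divide)
    ultimately show ?thesis using \<open>c > 0\<close> by (simp add: normal_density_def)
  qed
  then have "(\<integral>\<^sup>+s. ennreal (normal_density 0 \<sigma> s) * ennreal (exp (t * s\<^sup>2)) \<partial>lborel)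
      = (\<integral>\<^sup>+s. ennreal (1 / sqrt c) * ennreal (normal_density 0 \<tau> s) \<partial>lborel)"
    using \<open>c > 0\<close>
    by (simp only: ennreal_mult'[symmetric] normal_density_nonneg) (simp add: ennreal_mult'[symmetric])
  also have "\<dots> = ennreal (1 / sqrt c) * (\<integral>\<^sup>+s. ennreal (normal_density 0 \<tau> s) \<partial>lborel)"
    by (rule nn_integral_cmult) simp
  also have "(\<integral>\<^sup>+s. ennreal (normal_density 0 \<tau> s) \<partial>lborel) = 1"
    using \<open>\<tau> > 0\<close> by (subst nn_integral_eq_integral) (auto intro: integrable_normal_density)
  finally show ?thesis by (simp add: c_def)
qed

lemma nn_integral_exp_mean:
  assumes "k > 0" and "t < 1 / 2"
  shows "(\<integral>\<^sup>+w. exp_mean t k w \<partial>gauss_seq) = ennreal (1 / sqrt (1 - 2 * t))"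
proof -
  have "(\<integral>\<^sup>+w. exp_mean t k w \<partial>gauss_seq)
      = (\<integral>\<^sup>+w. ennreal (exp (t / real k * (\<Sum>l<k. w l)\<^sup>2)) \<partial>gauss_seq)"
    using \<open>k > 0\<close> by (simp add: exp_mean_def prefix_mean_def power2_eq_square)
  also have "\<dots> = (\<integral>\<^sup>+s. ennreal (normal_density 0 (sqrt (real k)) s)
      * ennreal (exp (t / real k * s\<^sup>2)) \<partial>lborel)"
    by (subst distributed_nn_integral[OF distributed_sum_gauss_seq[OF \<open>k > 0\<close>]]) auto
  also have "\<dots> = ennreal (1 / sqrt (1 - 2 * t))"
    using assms by (subst nn_integral_exp_square_normal) auto
  finally show ?thesis .
qed

lemma nn_integral_exp_gain_le: "(\<integral>\<^sup>+w. exp_gain (3 / 8) n w \<partial>gauss_seq) \<le> of_nat (n + 1)"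
proof (induction n rule: less_induct)
  case (less n)
  show ?case
  proof (cases "n = 0")
    case True
    then show ?thesis by (simp add: exp_gain_0 std_normal.emeasure_space_1[simplified])
  next
    case False
    have "(\<integral>\<^sup>+y. exp_mean (3 / 8) k y \<partial>gauss_seq) = 2" if "k > 0" for k
      using nn_integral_exp_mean[OF that, of "3 / 8"] by (simp add: real_sqrt_divide)
    then have "of_nat n * (\<integral>\<^sup>+w. exp_gain (3 / 8) n w \<partial>gauss_seq)
        \<le> (\<Sum>k\<in>{1..n}. 2 * (\<integral>\<^sup>+w. exp_gain (3 / 8) (n - k) w \<partial>gauss_seq))"
      using std_normal.nn_integral_exp_gain_recursion[of "3 / 8" n] by simp
    also have "\<dots> \<le> (\<Sum>k\<in>{1..n}. 2 * of_nat (n - k + 1))"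
      using False by (intro sum_mono mult_left_mono less) auto
    also have "\<dots> = (of_nat (\<Sum>k\<in>{1..n}. 2 * (n - k + 1)) :: ennreal)"
      unfolding of_nat_sum of_nat_mult of_nat_numeral ..
    also have "(\<Sum>k\<in>{1..n}. 2 * (n - k + 1)) = (\<Sum>k\<in>{1..n}. 2 * k)"
      by (rule sum.reindex_bij_witness[of _ "\<lambda>k. n + 1 - k" "\<lambda>k. n + 1 - k"]) auto
    also have "\<dots> = n * (n + 1)" by (induction n) auto
    finally have "of_nat n * (\<integral>\<^sup>+w. exp_gain (3 / 8) n w \<partial>gauss_seq) \<le> of_nat n * of_nat (n + 1)"
      by (simp only: of_nat_mult)
    then show ?thesis using False by (subst (asm) ennreal_mult_le_mult_iff) auto
  qed
qed

lemma nn_integral_valley_weight_le: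
  "(\<integral>\<^sup>+w. valley_weight (3 / 8) n w \<partial>gauss_seq) \<le> of_nat ((n + 1) ^ 3)"
proof -
  have "(\<integral>\<^sup>+w. valley_weight (3 / 8) n w \<partial>gauss_seq) \<le> (\<Sum>j\<le>n. of_nat ((n + 1) * (n + 1)))"
    unfolding std_normal.nn_integral_valley_weight of_nat_mult
  proof (intro sum_mono mult_mono)
    fix j assume "j \<in> {..n}"
    then have "of_nat (j + 1) \<le> (of_nat (n + 1) :: ennreal)" by (intro of_nat_mono) simp
    then show "(\<integral>\<^sup>+w. exp_gain (3 / 8) j w \<partial>gauss_seq) \<le> of_nat (n + 1)"
      by (rule order_trans[OF nn_integral_exp_gain_le])
    have "of_nat (n - j + 1) \<le> (of_nat (n + 1) :: ennreal)" by (intro of_nat_mono) simp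
    then show "(\<integral>\<^sup>+w. exp_gain (3 / 8) (n - j) w \<partial>gauss_seq) \<le> of_nat (n + 1)"
      by (rule order_trans[OF nn_integral_exp_gain_le])
  qed simp_all
  also have "\<dots> = of_nat (\<Sum>j\<le>n. (n + 1) * (n + 1))" by (simp only: of_nat_sum)
  also have "(\<Sum>j\<le>n. (n + 1) * (n + 1)) = (n + 1) ^ 3" by (simp add: power3_eq_cube)
  finally show ?thesis .
qed

section \<open>Convex sequences\<close>

lemma monotone_on_atLeastLessThan_SucI:
  fixes u :: "nat \<Rightarrow> 'a"
  assumes "reflp R" "transp R" and step: "\<And>l. a \<le> l \<Longrightarrow> Suc l < n \<Longrightarrow> R (u l) (u (Suc l))"
  shows "monotone_on {a..<n} (\<le>) R u"
proof (rule monotone_onI)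
  fix l m assume l: "l \<in> {a..<n}" and m: "m \<in> {a..<n}" and "l \<le> m"
  from \<open>l \<le> m\<close> m show "R (u l) (u m)"
  proof (induction m rule: dec_induct)
    case base
    show ?case using \<open>reflp R\<close> by (rule reflpD)
  next
    case (step m)
    then have "R (u l) (u m)" "R (u m) (u (Suc m))" using l assms(3)[of m] by auto
    then show ?case by (rule transpD[OF \<open>transp R\<close>])
  qed
qed

lemma slopes_mono_valley:
  fixes u x :: "nat \<Rightarrow> real"
  assumes x: "\<And>i. Suc i < n \<Longrightarrow> x i < x (Suc i)"
    and slopes: "\<And>i. Suc (Suc i) < n \<Longrightarrow>
      (u (Suc i) - u i) / (x (Suc i) - x i)
        \<le> (u (Suc (Suc i)) - u (Suc i)) / (x (Suc (Suc i)) - x (Suc i))"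
  obtains j where "j \<le> n" "antimono_on {..<j} u" "mono_on {j..<n} u"
proof -
  define slope where "slope i = (u (Suc i) - u i) / (x (Suc i) - x i)" for i
  have neg: "slope i < 0 \<longleftrightarrow> u (Suc i) < u i" if "Suc i < n" for i
    using x[OF that] by (simp add: slope_def divide_less_0_iff)
  have "mono_on {0..<n - 1} slope"
    by (rule monotone_on_atLeastLessThan_SucI) (use slopes in \<open>auto simp: slope_def\<close>)
  then have "slope i \<le> slope m" if "i \<le> m" "m < n - 1" for i m
    using that by (auto intro: mono_onD)
  then have "slope i < 0" if "i \<le> m" "m < n - 1" "slope m < 0" for i m
    using that by (meson order_le_less_trans)
  then obtain j where j: "j \<le> n - 1" and sign: "\<And>i. i < n - 1 \<Longrightarrow> slope i < 0 \<longleftrightarrow> i < j"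
    using downward_closed_initial_segment[of "n - 1" "\<lambda>i. slope i < 0"] by blast
  have "antimono_on {0..<j} u"
  proof (rule monotone_on_atLeastLessThan_SucI)
    show "u (Suc i) \<le> u i" if "Suc i < j" for i
      using sign[of i] neg[of i] that j by simp
  qed auto
  moreover have "mono_on {j..<n} u"
  proof (rule monotone_on_atLeastLessThan_SucI)
    show "u i \<le> u (Suc i)" if "j \<le> i" "Suc i < n" for i
      using sign[of i] neg[of i] that by (simp add: less_diff_conv)
  qed auto
  ultimately show thesis using that[of j] j by (simp add: lessThan_atLeast0)
qed

lemma fit_gain_valley_le:
  assumes "j \<le> n" and dec: "antimono_on {..<j} u" and inc: "mono_on {j..<n} u"
  shows "fit_gain n w u
    \<le> isotonic_gain j (w \<circ> reverse_prefix j) + isotonic_gain (n - j) (delete_block 0 j w)"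
proof -
  define f where "f l = 2 * w l * u l - (u l)\<^sup>2" for l
  have "(\<Sum>l<j. f l) = fit_gain j (w \<circ> reverse_prefix j) (u \<circ> reverse_prefix j)"
    unfolding fit_gain_def f_def
    by (rule sum.reindex_bij_witness[of _ "\<lambda>l. j - 1 - l" "\<lambda>l. j - 1 - l"])
      (auto simp: reverse_prefix_def)
  also have "\<dots> \<le> isotonic_gain j (w \<circ> reverse_prefix j)"
    by (intro fit_gain_le_isotonic_gain mono_onI)
      (auto simp: reverse_prefix_def intro!: monotone_onD[OF dec])
  finally have "(\<Sum>l<j. f l) \<le> isotonic_gain j (w \<circ> reverse_prefix j)" .
  moreover have "(\<Sum>l<n - j. delete_block 0 j f l) \<le> isotonic_gain (n - j) (delete_block 0 j w)"
  proof -
    have "mono_on {..<n - j} (delete_block 0 j u)"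
      by (intro mono_onI) (auto simp: delete_block_def intro!: mono_onD[OF inc])
    then have "fit_gain (n - j) (delete_block 0 j w) (delete_block 0 j u)
        \<le> isotonic_gain (n - j) (delete_block 0 j w)"
      by (rule fit_gain_le_isotonic_gain)
    then show ?thesis by (simp add: fit_gain_def f_def delete_block_def)
  qed
  moreover have "fit_gain n w u = (\<Sum>l<j. f l) + (\<Sum>l<n - j. delete_block 0 j f l)"
    using sum_delete_block[of 0 "n - j" f j] \<open>j \<le> n\<close> by (simp add: fit_gain_def f_def)
  ultimately show ?thesis by simp
qed

lemma exp_fit_gain_le_valley_weight:
  assumes "0 \<le> t" and "j \<le> n" "antimono_on {..<j} u" "mono_on {j..<n} u"
  shows "ennreal (exp (t * fit_gain n w u)) \<le> valley_weight t n w"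
proof -
  have "t * fit_gain n w u
      \<le> t * isotonic_gain j (w \<circ> reverse_prefix j) + t * isotonic_gain (n - j) (delete_block 0 j w)"
    unfolding distrib_left[symmetric] using assms by (intro mult_left_mono fit_gain_valley_le)
  then have "ennreal (exp (t * fit_gain n w u))
      \<le> exp_gain t j (w \<circ> reverse_prefix j) * exp_gain t (n - j) (delete_block 0 j w)"
    unfolding exp_gain_def by (simp add: ennreal_mult[symmetric] exp_add[symmetric])
  also have "\<dots> \<le> valley_weight t n w"
    unfolding valley_weight_def using \<open>j \<le> n\<close>
    by (intro member_le_sum[where i = j
          and f = "\<lambda>j. exp_gain t j (w \<circ> reverse_prefix j) * exp_gain t (n - j) (delete_block 0 j w)"]) auto
  finally show ?thesis .
qed

section \<open>The cone of convex sequences\<close>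

definition slope_increment ::
  "real ^ 'n::{finite, linorder} \<Rightarrow> nat \<Rightarrow> real ^ 'n::{finite, linorder} \<Rightarrow> real" where
  "slope_increment x i u = (u $ idx (i + 1) - u $ idx i) / (x $ idx (i + 1) - x $ idx i)
    - (u $ idx i - u $ idx (i - 1)) / (x $ idx i - x $ idx (i - 1))"

definition vec_seq :: "real ^ 'n::{finite, linorder} \<Rightarrow> nat \<Rightarrow> real" where
  "vec_seq z i = z $ idx (Suc i)"

lemma convex_seq_cone_eq_Inter:
  "convex_seq_cone x =
    (\<Inter>i\<in>{2..CARD('n) - 1}. {u :: real ^ 'n::{finite, linorder}. 0 \<le> slope_increment x i u})"
  by (auto simp: convex_seq_cone_def slope_increment_def)

lemma linear_slope_increment: "linear (slope_increment x i)"
  by (rule linearI)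
    (simp_all add: slope_increment_def diff_divide_distrib add_divide_distrib right_diff_distrib)

lemma closed_convex_seq_cone: "closed (convex_seq_cone x)"
  unfolding convex_seq_cone_eq_Inter slope_increment_def
  by (intro closed_INT ballI closed_Collect_le) (auto simp: divide_inverse intro!: continuous_intros)

lemma convex_cone_Collect_linear_nonneg:
  fixes f :: "'a::real_vector \<Rightarrow> real"
  assumes "linear f"
  shows "convex_cone {u. 0 \<le> f u}"
  using assms by (simp add: convex_cone_iff linear_0 linear_add linear_scale)

lemma convex_cone_convex_seq_cone: "convex_cone (convex_seq_cone x)"
  unfolding convex_seq_cone_eq_Inter
  by (intro convex_cone_Inter) (auto intro: convex_cone_Collect_linear_nonneg linear_slope_increment)

lemma power2_norm_closest_point_convex_cone:
  fixes L :: "'a::euclidean_space set"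
  assumes "closed L" and L: "convex_cone L"
  shows "(norm (closest_point L z))\<^sup>2 = 2 * (z \<bullet> closest_point L z) - (norm (closest_point L z))\<^sup>2"
proof -
  define p where "p = closest_point L z"
  have "p \<in> L"
    unfolding p_def using \<open>closed L\<close> convex_cone_nonempty[OF L] by (rule closest_point_in_set)
  then have "0 \<in> L" "2 *\<^sub>R p \<in> L"
    using L by (auto intro: convex_cone_contains_0 convex_cone_scaleR)
  moreover have "(z - p) \<bullet> (y - p) \<le> 0" if "y \<in> L" for y
    using L \<open>closed L\<close> that unfolding p_def convex_cone_def by (intro closest_point_dot) auto
  ultimately have "(z - p) \<bullet> (0 - p) \<le> 0" "(z - p) \<bullet> (2 *\<^sub>R p - p) \<le> 0" by blast+
  then have "z \<bullet> p = p \<bullet> p" by (simp add: inner_diff_left inner_diff_right scaleR_2 inner_add_right)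
  then show ?thesis by (simp add: p_def power2_norm_eq_inner)
qed

lemma bij_betw_idx: "bij_betw (\<lambda>i. idx (Suc i)) {..<CARD('n)} (UNIV :: 'n::{finite, linorder} set)"
  using bij_betw_nth[of "sorted_list_of_set (UNIV :: 'n set)" "{..<CARD('n)}" UNIV]
  by (simp add: idx_def)

lemma idx_less:
  assumes "i < j" "j < CARD('n)"
  shows "(idx (Suc i) :: 'n::{finite, linorder}) < idx (Suc j)"
  using strict_sorted_list_of_set[of "UNIV :: 'n set"] assms
  by (simp add: idx_def sorted_wrt_iff_nth_less)

lemma inner_vec_seq: "y \<bullet> z = (\<Sum>i<CARD('n). vec_seq y i * vec_seq z i)"
  for y z :: "real ^ 'n::{finite, linorder}"
  unfolding inner_vec_def vec_seq_def inner_real_def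
  by (rule sum.reindex_bij_betw[OF bij_betw_idx, symmetric])

lemma convex_seq_cone_valley:
  fixes x u :: "real ^ 'n::{finite, linorder}"
  assumes "strict_mono (($) x)" and u: "u \<in> convex_seq_cone x"
  obtains j where "j \<le> CARD('n)" "antimono_on {..<j} (vec_seq u)" "mono_on {j..<CARD('n)} (vec_seq u)"
proof (rule slopes_mono_valley)
  show "vec_seq x i < vec_seq x (Suc i)" if "Suc i < CARD('n)" for i
    using that assms(1) idx_less[of i "Suc i", where 'n = 'n]
    by (simp add: vec_seq_def strict_mono_def)
  show "(vec_seq u (Suc i) - vec_seq u i) / (vec_seq x (Suc i) - vec_seq x i)
      \<le> (vec_seq u (Suc (Suc i)) - vec_seq u (Suc i)) / (vec_seq x (Suc (Suc i)) - vec_seq x (Suc i))"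
    if "Suc (Suc i) < CARD('n)" for i
  proof -
    have "Suc (Suc i) \<in> {2..CARD('n) - 1}" using that by auto
    then show ?thesis using u unfolding convex_seq_cone_def vec_seq_def by fastforce
  qed
qed

lemma exp_closest_point_le_valley_weight:
  fixes x z :: "real ^ 'n::{finite, linorder}"
  assumes "strict_mono (($) x)" and "0 \<le> t"
  shows "ennreal (exp (t * (norm (closest_point (convex_seq_cone x) z))\<^sup>2))
    \<le> valley_weight t CARD('n) (vec_seq z)"
proof -
  define p where "p = closest_point (convex_seq_cone x) z"
  have "p \<in> convex_seq_cone x"
    unfolding p_def
    by (intro closest_point_in_set closed_convex_seq_cone convex_cone_nonempty
        convex_cone_convex_seq_cone)
  then obtain j where j: "j \<le> CARD('n)" "antimono_on {..<j} (vec_seq p)"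
      "mono_on {j..<CARD('n)} (vec_seq p)"
    using convex_seq_cone_valley[OF assms(1)] by blast
  have "(norm p)\<^sup>2 = 2 * (z \<bullet> p) - (norm p)\<^sup>2"
    unfolding p_def
    by (intro power2_norm_closest_point_convex_cone closed_convex_seq_cone convex_cone_convex_seq_cone)
  also have "\<dots> = fit_gain CARD('n) (vec_seq z) (vec_seq p)"
    unfolding fit_gain_def power2_norm_eq_inner inner_vec_seq
    by (simp add: sum_subtractf sum_distrib_left power2_eq_square mult.assoc)
  finally have "(norm p)\<^sup>2 = fit_gain CARD('n) (vec_seq z) (vec_seq p)" .
  then show ?thesis
    using exp_fit_gain_le_valley_weight[OF \<open>0 \<le> t\<close> j, of "vec_seq z"] by (simp add: p_def)
qed

section \<open>The standard Gaussian on Euclidean space\<close>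

lemma nn_integral_lborel_vec_prod:
  fixes f :: "'n::finite \<Rightarrow> real \<Rightarrow> ennreal"
  assumes [measurable]: "\<And>c. f c \<in> borel_measurable borel"
  shows "(\<integral>\<^sup>+z. (\<Prod>c\<in>UNIV. f c (z $ c)) \<partial>(lborel :: (real ^ 'n) measure))
    = (\<Prod>c\<in>UNIV. \<integral>\<^sup>+y. f c y \<partial>lborel)"
proof -
  define ax :: "'n \<Rightarrow> real ^ 'n" where "ax c = axis c 1" for c
  have inj: "inj ax" by (auto simp: ax_def inj_def axis_eq_axis)
  have Basis: "Basis = range ax" by (auto simp: Basis_vec_def ax_def)
  have "(\<integral>\<^sup>+z. (\<Prod>c\<in>UNIV. f c (z $ c)) \<partial>(lborel :: (real ^ 'n) measure))
      = (\<integral>\<^sup>+z. (\<Prod>b\<in>Basis. f (inv ax b) (z \<bullet> b)) \<partial>lborel)"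
    unfolding Basis prod.reindex[OF inj] by (simp add: inv_f_f[OF inj]) (simp add: ax_def inner_axis)
  also have "\<dots> = (\<Prod>b\<in>Basis. \<integral>\<^sup>+y. f (inv ax b) y \<partial>lborel)"
    by (rule nn_integral_lborel_prod) auto
  also have "\<dots> = (\<Prod>c\<in>UNIV. \<integral>\<^sup>+y. f c y \<partial>lborel)"
    unfolding Basis prod.reindex[OF inj] by (simp add: inv_f_f[OF inj])
  finally show ?thesis .
qed

lemma borel_measurable_std_gaussian_density [measurable]:
  "(std_gaussian_density :: real ^ 'n \<Rightarrow> real) \<in> borel_measurable borel"
  unfolding std_gaussian_density_def by measurable

lemma sets_std_gaussian [measurable_cong]: "sets std_gaussian = sets borel"
  by (simp add: std_gaussian_def)

lemma space_std_gaussian [simp]: "space std_gaussian = UNIV"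
  by (simp add: std_gaussian_def)

lemma emeasure_std_gaussian_Collect:
  fixes A :: "'n::finite \<Rightarrow> real set"
  assumes [measurable]: "\<And>c. A c \<in> sets borel"
  shows "emeasure std_gaussian {z. \<forall>c. z $ c \<in> A c} = (\<Prod>c\<in>UNIV. emeasure std_normal (A c))"
proof -
  have [measurable]: "{z :: real ^ 'n. \<forall>c. z $ c \<in> A c} \<in> sets borel" by measurable
  have "emeasure std_gaussian {z. \<forall>c. z $ c \<in> A c}
      = (\<integral>\<^sup>+z. ennreal (std_gaussian_density z) * indicator {z. \<forall>c. z $ c \<in> A c} z \<partial>lborel)"
    unfolding std_gaussian_def by (rule emeasure_density) auto
  also have "\<dots> = (\<integral>\<^sup>+z. (\<Prod>c\<in>UNIV. ennreal (std_normal_density (z $ c))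
      * indicator (A c) (z $ c)) \<partial>lborel)"
  proof (rule nn_integral_cong)
    fix z :: "real ^ 'n"
    have "indicator {z. \<forall>c. z $ c \<in> A c} z = (\<Prod>c\<in>UNIV. indicator (A c) (z $ c) :: ennreal)"
      by (auto simp: indicator_def prod_eq_1_iff intro!: prod_zero)
    then show "ennreal (std_gaussian_density z) * indicator {z. \<forall>c. z $ c \<in> A c} z
        = (\<Prod>c\<in>UNIV. ennreal (std_normal_density (z $ c)) * indicator (A c) (z $ c))"
      by (simp add: std_gaussian_density_def prod_ennreal prod.distrib)
  qed
  also have "\<dots> = (\<Prod>c\<in>UNIV. emeasure std_normal (A c))"
    by (subst nn_integral_lborel_vec_prod) (simp_all add: emeasure_density)
  finally show ?thesis .
qed

lemma prob_space_std_gaussian: "prob_space (std_gaussian :: (real ^ 'n::finite) measure)"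
proof
  have "emeasure std_normal UNIV = 1"
    using prob_space.emeasure_space_1[OF prob_space_normal_density[of 1 0]] by simp
  then show "emeasure (std_gaussian :: (real ^ 'n) measure) (space std_gaussian) = 1"
    using emeasure_std_gaussian_Collect[of "\<lambda>_::'n. UNIV"] by simp
qed

lemma distr_std_gaussian_coordinates:
  fixes \<sigma> :: "'i \<Rightarrow> 'n::finite"
  assumes \<sigma>: "bij_betw \<sigma> I UNIV"
  shows "distr std_gaussian (PiM I (\<lambda>_. std_normal)) (\<lambda>z. \<lambda>i\<in>I. z $ \<sigma> i) = PiM I (\<lambda>_. std_normal)"
proof -
  interpret product_sigma_finite "\<lambda>_ :: 'i. std_normal" by unfold_locales
  show ?thesis
  proof (rule PiM_eqI)
    show "finite I" using bij_betw_finite[OF \<sigma>] by simp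
    fix A :: "'i \<Rightarrow> real set"
    assume A: "\<And>i. i \<in> I \<Longrightarrow> A i \<in> sets std_normal"
    define \<tau> where "\<tau> = inv_into I \<sigma>"
    have \<tau>: "\<tau> c \<in> I" "\<sigma> (\<tau> c) = c" for c
      using \<sigma> by (auto simp: \<tau>_def bij_betw_def inv_into_into f_inv_into_f)
    have \<tau>\<sigma>: "\<tau> (\<sigma> i) = i" if "i \<in> I" for i
      using \<sigma> that by (simp add: \<tau>_def bij_betw_def)
    have "(\<lambda>z. \<lambda>i\<in>I. z $ \<sigma> i) -` PiE I A = {z. \<forall>c. z $ c \<in> A (\<tau> c)}"
    proof (intro set_eqI iffI)
      show "z \<in> {z. \<forall>c. z $ c \<in> A (\<tau> c)}" if "z \<in> (\<lambda>z. \<lambda>i\<in>I. z $ \<sigma> i) -` PiE I A" for z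
        using that \<tau> by (auto simp: PiE_iff) metis
      show "z \<in> (\<lambda>z. \<lambda>i\<in>I. z $ \<sigma> i) -` PiE I A" if "z \<in> {z. \<forall>c. z $ c \<in> A (\<tau> c)}" for z
        using that \<tau>\<sigma> by (auto simp: PiE_iff) metis
    qed
    then have "emeasure (distr std_gaussian (PiM I (\<lambda>_. std_normal)) (\<lambda>z. \<lambda>i\<in>I. z $ \<sigma> i)) (PiE I A)
        = emeasure std_gaussian {z. \<forall>c. z $ c \<in> A (\<tau> c)}"
      using A \<open>finite I\<close> by (subst emeasure_distr) (auto intro!: sets_PiM_I_finite measurable_restrict)
    also have "\<dots> = (\<Prod>c\<in>UNIV. emeasure std_normal (A (\<tau> c)))"
      using A \<tau> by (intro emeasure_std_gaussian_Collect) simp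
    also have "\<dots> = (\<Prod>i\<in>I. emeasure std_normal (A (\<tau> (\<sigma> i))))"
      by (rule prod.reindex_bij_betw[OF \<sigma>, symmetric])
    also have "\<dots> = (\<Prod>i\<in>I. emeasure std_normal (A i))"
      by (intro prod.cong refl) (simp add: \<tau>\<sigma>)
    finally show
      "emeasure (distr std_gaussian (PiM I (\<lambda>_. std_normal)) (\<lambda>z. \<lambda>i\<in>I. z $ \<sigma> i)) (PiE I A)
        = (\<Prod>i\<in>I. emeasure std_normal (A i))" .
  qed simp
qed

lemma nn_integral_std_gaussian_vec_seq:
  fixes F :: "(nat \<Rightarrow> real) \<Rightarrow> ennreal"
  assumes [measurable]: "F \<in> borel_measurable borel" and F: "prefix_determined CARD('n) F"
  shows "(\<integral>\<^sup>+z. F (vec_seq z) \<partial>(std_gaussian :: (real ^ 'n::{finite, linorder}) measure))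
    = (\<integral>\<^sup>+w. F w \<partial>gauss_seq)"
proof -
  let ?G = "std_gaussian :: (real ^ 'n::{finite, linorder}) measure"
  let ?I = "{..<CARD('n)}"
  let ?P = "PiM ?I (\<lambda>_. std_normal)"
  define extend where "extend v i = (if i \<in> ?I then v i else 0)" for v :: "nat \<Rightarrow> real" and i
  have [measurable]: "(\<lambda>v. F (extend v)) \<in> borel_measurable ?P"
  proof (rule measurable_compose[OF measurable_seqI \<open>F \<in> borel_measurable borel\<close>])
    fix i
    show "(\<lambda>v. extend v i) \<in> borel_measurable ?P"
      using measurable_component_singleton[of i ?I "\<lambda>_. std_normal"]
      by (cases "i \<in> ?I") (auto simp: extend_def)
  qed
  have F_extend: "F (extend (restrict w ?I)) = F w" for w
    by (rule prefix_determinedD[OF F]) (simp add: extend_def)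
  have "(\<integral>\<^sup>+z. F (vec_seq z) \<partial>?G) = (\<integral>\<^sup>+v. F (extend v) \<partial>distr ?G ?P (\<lambda>z. restrict (vec_seq z) ?I))"
    by (subst nn_integral_distr) (auto simp: F_extend vec_seq_def intro!: measurable_restrict)
  also have "distr ?G ?P (\<lambda>z. restrict (vec_seq z) ?I) = ?P"
    using distr_std_gaussian_coordinates[OF bij_betw_idx[where 'n = 'n]]
    by (simp add: vec_seq_def[abs_def])
  also have "?P = distr gauss_seq ?P (\<lambda>w. restrict w ?I)"
    using distr_PiM_reindex[of UNIV "\<lambda>_. std_normal" "\<lambda>i. i" ?I]
    by (simp add: prob_space_normal_density)
  also have "(\<integral>\<^sup>+v. F (extend v) \<partial>distr gauss_seq ?P (\<lambda>w. restrict w ?I)) = (\<integral>\<^sup>+w. F w \<partial>gauss_seq)"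
    by (subst nn_integral_distr) (auto simp: F_extend intro!: measurable_restrict)
  finally show ?thesis .
qed

section \<open>The bound on the statistical dimension\<close>

lemma (in prob_space) expectation_le_ln_exp_moment:
  fixes V :: "'a \<Rightarrow> real"
  assumes [measurable]: "V \<in> borel_measurable M" and nonneg: "\<And>\<omega>. 0 \<le> V \<omega>" and "0 < t" "0 \<le> C"
    and moment: "(\<integral>\<^sup>+\<omega>. ennreal (exp (t * V \<omega>)) \<partial>M) \<le> ennreal C"
  shows "integrable M V" "expectation V \<le> ln C / t"
proof -
  have exp_int: "integrable M (\<lambda>\<omega>. exp (t * V \<omega>))"
    using moment by (intro integrableI_bounded) (auto simp: less_top[symmetric] top_unique)
  have "t * V \<omega> \<le> exp (t * V \<omega>)" for \<omega>
    using exp_ge_add_one_self[of "t * V \<omega>"] by linarith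
  then have "integrable M (\<lambda>\<omega>. t * V \<omega>)"
    using nonneg \<open>0 < t\<close> by (intro Bochner_Integration.integrable_bound[OF exp_int]) auto
  then show V: "integrable M V" using \<open>0 < t\<close> by simp
  have "exp (t * expectation V) \<le> expectation (\<lambda>\<omega>. exp (t * V \<omega>))"
    using jensens_inequality[of "\<lambda>\<omega>. t * V \<omega>" UNIV _ _ exp] V exp_int exp_convex by simp
  also have "\<dots> \<le> C" using \<open>0 \<le> C\<close> moment by (rule integral_real_bounded)
  finally have "exp (t * expectation V) \<le> C" .
  then have "t * expectation V \<le> ln C"
    by (subst ln_ge_iff) (auto intro: order_less_le_trans[OF exp_gt_zero])
  then show "expectation V \<le> ln C / t" using \<open>0 < t\<close> by (simp add: field_simps)
qed

lemma nn_integral_exp_closest_point_convex_seq_cone_le: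
  fixes x :: "real ^ 'n::{finite, linorder}"
  assumes "strict_mono (($) x)"
  shows "(\<integral>\<^sup>+z. ennreal (exp (3 / 8 * (norm (closest_point (convex_seq_cone x) z))\<^sup>2)) \<partial>std_gaussian)
    \<le> ennreal ((exp 1 * real CARD('n)) ^ 3)"
proof -
  have "(\<integral>\<^sup>+z. ennreal (exp (3 / 8 * (norm (closest_point (convex_seq_cone x) z))\<^sup>2)) \<partial>std_gaussian)
      \<le> (\<integral>\<^sup>+z. valley_weight (3 / 8) CARD('n) (vec_seq z)
        \<partial>(std_gaussian :: (real ^ 'n::{finite, linorder}) measure))"
    by (intro nn_integral_mono exp_closest_point_le_valley_weight assms) simp
  also have "\<dots> = (\<integral>\<^sup>+w. valley_weight (3 / 8) CARD('n) w \<partial>gauss_seq)"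
    by (intro nn_integral_std_gaussian_vec_seq prefix_determined_valley_weight) simp
  also have "\<dots> \<le> of_nat ((CARD('n) + 1) ^ 3)" by (rule nn_integral_valley_weight_le)
  also have "\<dots> = ennreal ((real CARD('n) + 1) ^ 3)"
    by (simp add: ennreal_of_nat_eq_real_of_nat add.commute)
  also have "\<dots> \<le> ennreal ((exp 1 * real CARD('n)) ^ 3)"
  proof (intro ennreal_leI power_mono)
    have "real CARD('n) + 1 \<le> 2 * real CARD('n)" by (simp add: Suc_le_eq)
    also have "\<dots> \<le> exp 1 * real CARD('n)"
      using exp_ge_add_one_self[of 1] by (intro mult_right_mono) auto
    finally show "real CARD('n) + 1 \<le> exp 1 * real CARD('n)" .
  qed simp
  finally show ?thesis .
qed

lemma borel_measurable_closest_point: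
  fixes L :: "'a::euclidean_space set"
  assumes "closed L" "convex L" "L \<noteq> {}"
  shows "closest_point L \<in> borel_measurable borel"
  using assms by (intro borel_measurable_continuous_onI continuous_on_closest_point)

lemma borel_measurable_closest_point_convex_seq_cone [measurable]:
  "closest_point (convex_seq_cone x) \<in> borel_measurable borel"
  using convex_cone_convex_seq_cone[of x] closed_convex_seq_cone[of x]
  by (intro borel_measurable_closest_point) (auto simp: convex_cone_def)

lemma statistical_dimension_convex_seq_cone:
  fixes x :: "real ^ 'n::{finite, linorder}"
  assumes "strict_mono (($) x)"
  shows "integrable std_gaussian (\<lambda>z. (norm (closest_point (convex_seq_cone x) z))\<^sup>2)"
    and "statistical_dimension (convex_seq_cone x) \<le> 8 * ln (exp 1 * real CARD('n))"
proof -
  interpret prob_space "std_gaussian :: (real ^ 'n::{finite, linorder}) measure"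
    by (rule prob_space_std_gaussian)
  define V where "V = (\<lambda>z. (norm (closest_point (convex_seq_cone x) z))\<^sup>2)"
  have meas: "V \<in> borel_measurable std_gaussian" unfolding V_def by measurable
  have nonneg: "0 \<le> V z" for z by (simp add: V_def)
  have moment: "(\<integral>\<^sup>+z. ennreal (exp (3 / 8 * V z)) \<partial>std_gaussian)
      \<le> ennreal ((exp 1 * real CARD('n)) ^ 3)"
    unfolding V_def by (rule nn_integral_exp_closest_point_convex_seq_cone_le[OF assms])
  have V: "integrable std_gaussian V" "expectation V \<le> ln ((exp 1 * real CARD('n)) ^ 3) / (3 / 8)"
    by (rule expectation_le_ln_exp_moment[OF meas nonneg _ _ moment]; simp)+
  show "integrable std_gaussian (\<lambda>z. (norm (closest_point (convex_seq_cone x) z))\<^sup>2)"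
    using V(1) by (simp add: V_def)
  have "ln ((exp 1 * real CARD('n)) ^ 3) / (3 / 8) = 8 * ln (exp 1 * real CARD('n))"
    by (simp add: ln_realpow)
  then show "statistical_dimension (convex_seq_cone x) \<le> 8 * ln (exp 1 * real CARD('n))"
    using V(2) by (simp add: statistical_dimension_def V_def)
qed

theorem theorem4p1:
  fixes x :: "real ^ 'n::{finite, linorder}"
    and M :: "'w measure"
    and g :: "'w \<Rightarrow> real ^ 'n::{finite, linorder}"
  assumes "CARD('n) \<ge> 3"
    and "strict_mono (($) x)"
    and "prob_space M"
    and "distributed M lborel g (\<lambda>z. ennreal (std_gaussian_density z))"
  shows "integrable M (\<lambda>\<omega>. (norm (closest_point (convex_seq_cone x) (g \<omega>)))\<^sup>2)
    \<and> statistical_dimension (convex_seq_cone x)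
        = prob_space.expectation M (\<lambda>\<omega>. (norm (closest_point (convex_seq_cone x) (g \<omega>)))\<^sup>2)
    \<and> prob_space.expectation M (\<lambda>\<omega>. (norm (closest_point (convex_seq_cone x) (g \<omega>)))\<^sup>2)
        \<le> 8 * ln (exp 1 * real CARD('n))"
proof -
  define V where "V z = (norm (closest_point (convex_seq_cone x) z))\<^sup>2" for z
  have [measurable]: "V \<in> borel_measurable borel" unfolding V_def by measurable
  have [measurable]: "g \<in> M \<rightarrow>\<^sub>M borel" using assms(4) by (simp add: distributed_def)
  have distr: "distr M lborel g = std_gaussian"
    using distributed_distr_eq_density[OF assms(4)] by (simp add: std_gaussian_def)
  have "integrable M (\<lambda>\<omega>. V (g \<omega>))"
    using statistical_dimension_convex_seq_cone(1)[OF assms(2)]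
    unfolding distr[symmetric] V_def[symmetric] by (subst (asm) integrable_distr_eq) auto
  moreover have "statistical_dimension (convex_seq_cone x) = (\<integral>\<omega>. V (g \<omega>) \<partial>M)"
    unfolding statistical_dimension_def distr[symmetric] V_def[symmetric]
    by (subst integral_distr) auto
  ultimately show ?thesis
    using statistical_dimension_convex_seq_cone(2)[OF assms(2)] by (simp add: V_def)
qed

end
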